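(* Let $\mu,L>0$ and $C_0\ge 0$ be such that: (i) the local costs $f_i:\mathbb{R}^n\times\mathbb{R}_+\to\mathbb{R}$ belong to $\mathcal{S}_{\mu,L}(\mathbb{R}^n)$ uniformly in $t$; (ii) $\|\nabla_{tx_i}f_i(x_i;t)\|\le C_0$ for all $x_i\in\mathbb{R}^n$, $t\in\mathbb{R}_+$ and all $i$; (iii) the solution $(x^*(t_k),y^*(t_k))$ of the problem $\min_{x,y}\{f(x;t_k)+\iota_{\ker(I-P)}(y)\}$ subject to $Ax-y=0$ is finite for every $k\in\mathbb{N}$. For each $k$ let $w^*(t_k)$ be a solution of the original dual problem, and assume that there is a constant $C$ with $\max\{\|w^*(t_k)\|,\|w^*(\epsilon;t_k)\|\}\le C$ for every $k$ and every regularization parameter $\epsilon>0$ considered. Then there exists $\psi_0>0$ such that, for all small enough $\epsilon>0$, the following holds. Let $\rho>0$, let $N_P,N_C$ be such that $$\eta_1(\epsilon):=\zeta(N_C;\epsilon)\big[\zeta(N_P;\epsilon)+2\bar\kappa(\epsilon)\,\xi(N_P;\epsilon)\big]<1,$$ and let $\{x_k\}_{k\in\mathbb{N}}$ be the sequence of primal variables generated by the prediction-correction dual-regularized ADMM with parameters $\epsilon,\rho$ and horizons $N_P,N_C$. Then $\{x_k\}$ converges to a neighborhood of the original optimal trajectory $\{x^*(t_k)\}$ with $$\limsup_{k\to\infty}\|x_k-x^*(t_k)\|\le\frac{\|A\|}{\mu}\left[\frac{\eta_0(\epsilon)}{1-\eta_1(\epsilon)}+C(1+\psi_0\epsilon)\right],$$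 where $$\eta_0(\epsilon):=\zeta(N_C;\epsilon)\,\frac{\bar C_0T_s}{\bar\mu(\epsilon)}\big[\zeta(N_P;\epsilon)+2(1+\bar\kappa(\epsilon)\,\xi(N_P;\epsilon))\big].$$
   Context: Setting. $\mathcal{G}=(\mathcal{V},\mathcal{E})$ is an undirected connected graph with $N$ nodes; $\mathcal{N}_i$ is the neighborhood of node $i$, $d_i=|\mathcal{N}_i|$, $d_M=\max_i d_i$. Node $i$ holds a time-varying cost $f_i(x_i;t)$. Sampling times $t_k$, $k\in\mathbb{N}$, satisfy $t_{k+1}-t_k=T_s>0$; write $f_{i,k}=f_i(\cdot;t_k)$. For $x=(x_1,\dots,x_N)\in\mathbb{R}^{nN}$, $f(x;t)=\sum_i f_i(x_i;t)$. $\mathcal{S}_{\mu,L}(\mathbb{R}^m)$ is the class of $\mu$-strongly convex functions on $\mathbb{R}^m$ with $L$-Lipschitz gradient; "uniformly in $t$" means with constants independent of $t$. The derivatives used below ($\nabla_{x_i}f_i$, Hessian $\nabla_{x_ix_i}f_i$, and $\nabla_{tx_i}f_i$, the time derivative of $\nabla_{x_i}f_i$) exist. Vectors $w,y,z\in\mathbb{R}^{2n|\mathcal{E}|}$ have blocks indexed by ordered pairs $(i,j)$ of adjacent nodes, each in $\mathbb{R}^n$. $A$ is the matrix with $(Ax)_{ij}=x_i$, and $\|A\|$ is its spectral norm; $P$ is the permutation matrix with $(Py)_{ij}=y_{ji}$; $\iota_{\mathbb{X}}$ is the indicator function of $\mathbb{X}$ ($0$ on $\mathbb{X}$, $+\infty$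 elsewhere); $h=\iota_{\ker(I-P)}$. Convex conjugate: $g^\star(w)=\sup_x\{\langle w,x\rangle-g(x)\}$. The original dual problem at $t_k$ is $\min_w\{f^\star(A^\top w;t_k)+h^\star(-w)\}$. The regularized dual solution is $w^*(\epsilon;t_k)=\arg\min_w\{\frac{\epsilon}{2}\|w\|^2+f^\star(A^\top w;t_k)+h^\star(-w)\}$. Constants. $\bar\mu(\epsilon)=\epsilon$, $\bar L(\epsilon)=\epsilon+d_M/\mu$, $\bar\kappa(\epsilon)=\bar L(\epsilon)/\bar\mu(\epsilon)=1+d_M/(\mu\epsilon)$, $\bar C_0=\sqrt{d_M}\,C_0/\mu$, $$\lambda(\epsilon)=\max\left\{\left|\frac{1-\rho\bar L(\epsilon)}{1+\rho\bar L(\epsilon)}\right|,\left|\frac{1-\rho\bar\mu(\epsilon)}{1+\rho\bar\mu(\epsilon)}\right|\right\},\qquad \omega(\epsilon)=\frac{1+\rho\bar L(\epsilon)}{1+\rho\bar\mu(\epsilon)}.$$ $\zeta(0;\epsilon)=1$ and $\zeta(\ell;\epsilon)=\omega(\epsilon)\lambda(\epsilon)^\ell$ for $\ell\ge1$; $\xi(0;\epsilon)=0$ and $\xi(\ell;\epsilon)=1+\omega(\epsilon)\lambda(\epsilon)^\ell$ for $\ell\ge1$. Algorithm. Let $\delta=1/(1+\epsilon\rho)$. Given local costs $g_1,\dots,g_N$ and $z$, define for each $i$ $$x_i(z;g)=\arg\min_{x_i\in\mathbb{R}^n}\Big\{g_i(x_i)+\frac{\rho\delta d_i}{2}\|x_i\|^2-\delta\big\langle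 x_i,\sum_{j\in\mathcal{N}_i}z_{ij}\big\rangle\Big\}.$$ One step of the distributed dual-regularized ADMM with costs $g$ replaces $z$ by $z^+$ with $z^+_{ij}=(1-2\delta)z_{ji}+2\delta\rho\,x_j(z;g)$. The horizons $N_P,N_C$ are nonnegative integers. Start from a given $x_0=(x_{1,0},\dots,x_{N,0})$ and $z_0=0$. For $k=0,1,\dots$: (prediction) let $\hat f_{i,k+1}$ be the quadratic function with gradient $\nabla\hat f_{i,k+1}(x_i)=\nabla_{x_i}f_{i,k}(x_{i,k})+\nabla_{x_ix_i}f_{i,k}(x_{i,k})(x_i-x_{i,k})+T_s\nabla_{tx_i}f_{i,k}(x_{i,k})$; apply $N_P$ ADMM steps with costs $\hat f_{i,k+1}$ starting from $z_k$, obtaining $\hat z_{k+1}$; (correction) apply $N_C$ ADMM steps with costs $f_{i,k+1}$ starting from $\hat z_{k+1}$, obtaining $z_{k+1}$, and set $x_{i,k+1}=x_i(z_{k+1};f_{\cdot,k+1})$. The generated primal variables are $x_k=(x_{1,k},\dots,x_{N,k})$. *)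

theory Defs
  imports "HOL-Analysis.Analysis"
begin

definition grad :: "('a::real_inner \<Rightarrow> real) \<Rightarrow> 'a \<Rightarrow> 'a" where
  "grad g x = (THE d. GDERIV g x :> d)"

definition strongly_convex :: "real \<Rightarrow> ('a::real_inner \<Rightarrow> real) \<Rightarrow> bool" where
  "strongly_convex \<mu> g \<longleftrightarrow> convex_on UNIV (\<lambda>x. g x - \<mu> / 2 * (norm x)\<^sup>2)"

definition S_class :: "real \<Rightarrow> real \<Rightarrow> ('a::real_inner \<Rightarrow> real) set" where
  "S_class \<mu> L = {g. strongly_convex \<mu> g \<and>
     (\<forall>x. \<exists>d. GDERIV g x :> d) \<and> L-lipschitz_on UNIV (grad g)}"

definition ext_indicator :: "'a set \<Rightarrow> 'a \<Rightarrow> ereal" where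
  "ext_indicator X x = (if x \<in> X then 0 else \<infinity>)"

text \<open>Convex conjugate of a function whose underlying Euclidean space is the subspace
  \<open>V\<close> of the ambient type.\<close>

definition convex_conj :: "'a::real_inner set \<Rightarrow> ('a \<Rightarrow> ereal) \<Rightarrow> 'a \<Rightarrow> ereal" where
  "convex_conj V g w = (SUP x\<in>V. ereal (w \<bullet> x) - g x)"

text \<open>The nodes are the elements of a finite type \<open>'v\<close>, so that \<open>real^'n^'v\<close> with its
  Euclidean norm is the space of stacked primal variables. An undirected simple graph is given
  by the set of ordered pairs of adjacent nodes.\<close>

definition connected_graph :: "('v \<times> 'v) set \<Rightarrow> bool" where
  "connected_graph E \<longleftrightarrow> sym E \<and> irrefl E \<and> (\<forall>i j. (i, j) \<in> E\<^sup>*)"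

definition max_degree :: "('v::finite \<times> 'v) set \<Rightarrow> nat" where
  "max_degree E = Max (range (\<lambda>i. card (E `` {i})))"

text \<open>Vectors with one block per ordered pair of adjacent nodes: the blocks of all other pairs
  are required to vanish, which affects neither inner products nor norms.\<close>

definition edge_space :: "('v \<times> 'v) set \<Rightarrow> (real^'n^('v::finite \<times> 'v)) set" where
  "edge_space E = {w. \<forall>e. e \<notin> E \<longrightarrow> w $ e = 0}"

definition A_op :: "('v \<times> 'v) set \<Rightarrow> real^'n^'v::finite \<Rightarrow> real^'n^('v \<times> 'v)" where
  "A_op E x = (\<chi> e. if e \<in> E then x $ fst e else 0)"

definition P_op :: "real^'n^('v::finite \<times> 'v) \<Rightarrow> real^'n^('v \<times> 'v)" where
  "P_op y = (\<chi> e. y $ (snd e, fst e))"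

definition ker_I_P :: "('v \<times> 'v) set \<Rightarrow> (real^'n^('v::finite \<times> 'v)) set" where
  "ker_I_P E = {y \<in> edge_space E. y - P_op y = 0}"

definition total_cost ::
  "('v \<Rightarrow> real^'n \<Rightarrow> real \<Rightarrow> real) \<Rightarrow> real \<Rightarrow> real^'n^'v::finite \<Rightarrow> real" where
  "total_cost f t x = (\<Sum>i\<in>UNIV. f i (x $ i) t)"

definition is_primal_solution ::
  "('v \<times> 'v) set \<Rightarrow> ('v \<Rightarrow> real^'n \<Rightarrow> real \<Rightarrow> real) \<Rightarrow> real \<Rightarrow>
   real^'n^'v::finite \<Rightarrow> real^'n^('v \<times> 'v) \<Rightarrow> bool" where
  "is_primal_solution E f t x y \<longleftrightarrow>
     is_arg_min (\<lambda>(x, y). ereal (total_cost f t x) + ext_indicator (ker_I_P E) y)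
       (\<lambda>(x, y). y \<in> edge_space E \<and> A_op E x - y = 0) (x, y)"

definition dual_cost ::
  "('v \<times> 'v) set \<Rightarrow> ('v \<Rightarrow> real^'n \<Rightarrow> real \<Rightarrow> real) \<Rightarrow> real \<Rightarrow>
   real^'n^('v::finite \<times> 'v) \<Rightarrow> ereal" where
  "dual_cost E f t w =
     convex_conj UNIV (\<lambda>x. ereal (total_cost f t x)) (adjoint (A_op E) w)
     + convex_conj (edge_space E) (ext_indicator (ker_I_P E)) (- w)"

definition is_dual_solution ::
  "('v \<times> 'v) set \<Rightarrow> ('v \<Rightarrow> real^'n \<Rightarrow> real \<Rightarrow> real) \<Rightarrow> real \<Rightarrow>
   real^'n^('v::finite \<times> 'v) \<Rightarrow> bool" where
  "is_dual_solution E f t w \<longleftrightarrow> is_arg_min (dual_cost E f t) (\<lambda>w. w \<in> edge_space E) w"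

definition reg_dual_solution ::
  "('v \<times> 'v) set \<Rightarrow> ('v \<Rightarrow> real^'n \<Rightarrow> real \<Rightarrow> real) \<Rightarrow> real \<Rightarrow> real \<Rightarrow>
   real^'n^('v::finite \<times> 'v)" where
  "reg_dual_solution E f \<epsilon> t =
     arg_min (\<lambda>w. ereal (\<epsilon> / 2 * (norm w)\<^sup>2) + dual_cost E f t w) (\<lambda>w. w \<in> edge_space E)"

definition local_min ::
  "('v \<times> 'v) set \<Rightarrow> real \<Rightarrow> real \<Rightarrow> ('v \<Rightarrow> real^'n \<Rightarrow> real) \<Rightarrow>
   real^'n^('v::finite \<times> 'v) \<Rightarrow> 'v \<Rightarrow> real^'n" where
  "local_min E \<epsilon> \<rho> g z i =
     (let \<delta> = 1 / (1 + \<epsilon> * \<rho>) in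
      arg_min (\<lambda>y. g i y + \<rho> * \<delta> * real (card (E `` {i})) / 2 * (norm y)\<^sup>2
                   - \<delta> * (y \<bullet> (\<Sum>j\<in>E `` {i}. z $ (i, j)))) (\<lambda>_. True))"

definition admm_step ::
  "('v \<times> 'v) set \<Rightarrow> real \<Rightarrow> real \<Rightarrow> ('v \<Rightarrow> real^'n \<Rightarrow> real) \<Rightarrow>
   real^'n^('v::finite \<times> 'v) \<Rightarrow> real^'n^('v \<times> 'v)" where
  "admm_step E \<epsilon> \<rho> g z =
     (let \<delta> = 1 / (1 + \<epsilon> * \<rho>) in
      \<chi> e. if e \<in> E
           then (1 - 2 * \<delta>) *\<^sub>R z $ (snd e, fst e)
                + (2 * \<delta> * \<rho>) *\<^sub>R local_min E \<epsilon> \<rho> g z (snd e)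
           else 0)"

text \<open>Gradient at \<open>y\<close> of the predicted cost built at time \<open>t\<close> and point \<open>x\<close> for a sampling
  time \<open>Ts\<close>. The time derivative is one-sided at \<open>t = 0\<close>.\<close>

definition predicted_grad ::
  "(real^'n \<Rightarrow> real \<Rightarrow> real) \<Rightarrow> real \<Rightarrow> real \<Rightarrow> real^'n \<Rightarrow> real^'n \<Rightarrow> real^'n" where
  "predicted_grad h t Ts x y =
     grad (\<lambda>u. h u t) x
     + frechet_derivative (grad (\<lambda>u. h u t)) (at x) (y - x)
     + Ts *\<^sub>R vector_derivative (\<lambda>s. grad (\<lambda>u. h u s) x) (at t within {0..})"

text \<open>\<open>x\<close> is a sequence of primal variables generated by the algorithm, from an arbitrary
  initial point \<open>x 0\<close>. The predicted costs \<open>fh k i\<close> are specified by their gradients; these are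
  affine, so \<open>fh k i\<close> is quadratic and determined up to an additive constant, on which no
  minimizer depends.\<close>

definition pc_admm_sequence ::
  "('v \<times> 'v) set \<Rightarrow> ('v \<Rightarrow> real^'n \<Rightarrow> real \<Rightarrow> real) \<Rightarrow> (nat \<Rightarrow> real) \<Rightarrow> real \<Rightarrow>
   real \<Rightarrow> real \<Rightarrow> nat \<Rightarrow> nat \<Rightarrow> (nat \<Rightarrow> real^'n^'v::finite) \<Rightarrow> bool" where
  "pc_admm_sequence E f t Ts \<epsilon> \<rho> NP NC x \<longleftrightarrow>
     (\<exists>z zh fh. z 0 = 0 \<and>
       (\<forall>k.
         (\<forall>i y. GDERIV (fh (Suc k) i) y :> predicted_grad (f i) (t k) Ts (x k $ i) y) \<and>
         zh (Suc k) = (admm_step E \<epsilon> \<rho> (fh (Suc k)) ^^ NP) (z k) \<and>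
         z (Suc k) = (admm_step E \<epsilon> \<rho> (\<lambda>i u. f i u (t (Suc k))) ^^ NC) (zh (Suc k)) \<and>
         (\<forall>i. x (Suc k) $ i = local_min E \<epsilon> \<rho> (\<lambda>i u. f i u (t (Suc k))) (z (Suc k)) i)))"

text \<open>Throughout, \<open>d\<close> stands for the maximal degree.\<close>

definition mu_bar :: "real \<Rightarrow> real" where
  "mu_bar \<epsilon> = \<epsilon>"

definition L_bar :: "real \<Rightarrow> real \<Rightarrow> real \<Rightarrow> real" where
  "L_bar d \<mu> \<epsilon> = \<epsilon> + d / \<mu>"

definition kappa_bar :: "real \<Rightarrow> real \<Rightarrow> real \<Rightarrow> real" where
  "kappa_bar d \<mu> \<epsilon> = L_bar d \<mu> \<epsilon> / mu_bar \<epsilon>"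

definition C0_bar :: "real \<Rightarrow> real \<Rightarrow> real \<Rightarrow> real" where
  "C0_bar d \<mu> C0 = sqrt d * C0 / \<mu>"

definition rate :: "real \<Rightarrow> real \<Rightarrow> real \<Rightarrow> real \<Rightarrow> real" where
  "rate d \<mu> \<rho> \<epsilon> =
     max \<bar>(1 - \<rho> * L_bar d \<mu> \<epsilon>) / (1 + \<rho> * L_bar d \<mu> \<epsilon>)\<bar>
         \<bar>(1 - \<rho> * mu_bar \<epsilon>) / (1 + \<rho> * mu_bar \<epsilon>)\<bar>"

definition omega :: "real \<Rightarrow> real \<Rightarrow> real \<Rightarrow> real \<Rightarrow> real" where
  "omega d \<mu> \<rho> \<epsilon> = (1 + \<rho> * L_bar d \<mu> \<epsilon>) / (1 + \<rho> * mu_bar \<epsilon>)"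

definition zeta :: "real \<Rightarrow> real \<Rightarrow> real \<Rightarrow> nat \<Rightarrow> real \<Rightarrow> real" where
  "zeta d \<mu> \<rho> l \<epsilon> = (if l = 0 then 1 else omega d \<mu> \<rho> \<epsilon> * rate d \<mu> \<rho> \<epsilon> ^ l)"

definition xi :: "real \<Rightarrow> real \<Rightarrow> real \<Rightarrow> nat \<Rightarrow> real \<Rightarrow> real" where
  "xi d \<mu> \<rho> l \<epsilon> = (if l = 0 then 0 else 1 + omega d \<mu> \<rho> \<epsilon> * rate d \<mu> \<rho> \<epsilon> ^ l)"

definition eta1 :: "real \<Rightarrow> real \<Rightarrow> real \<Rightarrow> nat \<Rightarrow> nat \<Rightarrow> real \<Rightarrow> real" where
  "eta1 d \<mu> \<rho> NP NC \<epsilon> =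
     zeta d \<mu> \<rho> NC \<epsilon> * (zeta d \<mu> \<rho> NP \<epsilon> + 2 * kappa_bar d \<mu> \<epsilon> * xi d \<mu> \<rho> NP \<epsilon>)"

definition eta0 :: "real \<Rightarrow> real \<Rightarrow> real \<Rightarrow> real \<Rightarrow> real \<Rightarrow> nat \<Rightarrow> nat \<Rightarrow> real \<Rightarrow> real" where
  "eta0 d \<mu> C0 Ts \<rho> NP NC \<epsilon> =
     zeta d \<mu> \<rho> NC \<epsilon> * (C0_bar d \<mu> C0 * Ts / mu_bar \<epsilon>)
     * (zeta d \<mu> \<rho> NP \<epsilon> + 2 * (1 + kappa_bar d \<mu> \<epsilon> * xi d \<mu> \<rho> NP \<epsilon>))"

end

theory Submission imports Defs
begin

text \<open>The regularized dual \<open>\<epsilon>/2 \<parallel>w\<parallel>\<^sup>2 + f\<^sup>\<star>(A\<^sup>T w)\<close> over the antisymmetric \<open>w\<close> is solved by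
  Peaceman--Rachford splitting: the ADMM step is \<open>z \<mapsto> - P (2 w - z)\<close>, where \<open>w\<close> is the proximal
  point of \<open>z\<close>, i.e. \<open>z = w + \<rho> (\<epsilon> w + A x)\<close> with \<open>\<nabla>f(x) = A\<^sup>T w\<close>. This map
  contracts with factor \<open>\<lambda>(\<epsilon>)\<close> in \<open>z\<close>, but the proximal point \<open>w\<close> of a given \<open>z\<close> depends on the current
  cost, so a change of costs has to be paid for in the variable \<open>z\<close>. Moreover the uniform bound \<open>C0\<close> on the
  drift of each local gradient gives the drift of the stacked gradient only up to a factor \<open>\<surd>N\<close>.
  Both losses are absorbed for small \<open>\<epsilon>\<close>: all regularized dual solutions lie in the range
  of \<open>A - P A\<close>, on which the dual gradient is strongly monotone with a constant \<open>c\<close> that does not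
  depend on \<open>\<epsilon>\<close>. Hence the true drifts of the dual solutions are of order \<open>1/c\<close>, while \<open>\<eta>\<^sub>0\<close>
  and \<open>\<eta>\<^sub>1\<close> account for drifts of order \<open>1/\<epsilon>\<close>. One prediction-correction step therefore obeys
  \<open>e\<^sub>k\<^sub>+\<^sub>1 \<le> \<eta>\<^sub>1 e\<^sub>k + \<eta>\<^sub>0\<close> for the dual error, and the Tikhonov estimate
  \<open>\<parallel>w\<^sup>*(\<epsilon>) - w\<^sup>*\<parallel> \<le> \<parallel>w\<^sup>*\<parallel>\<close> adds at most \<open>C\<close>.\<close>

section \<open>Strongly monotone Lipschitz operators and the abstract dual\<close>

text \<open>Only the map is recorded, not a potential, so that true gradients, predicted gradients
  and the regularized dual operator are all handled by one notion.\<close>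

definition strongly_monotone_lipschitz :: "real \<Rightarrow> real \<Rightarrow> ('a::real_inner \<Rightarrow> 'a) \<Rightarrow> bool" where
  "strongly_monotone_lipschitz \<mu> L F \<longleftrightarrow>
     (\<forall>x y. \<mu> * (norm (x - y))\<^sup>2 \<le> (F x - F y) \<bullet> (x - y)) \<and>
     (\<forall>x y. norm (F x - F y) \<le> L * norm (x - y))"

text \<open>The forward step x - \<tau> (F x - p) is a contraction for the step size that minimizes
  1 - 2 \<tau> \<mu> + \<tau>^2 L^2, and its fixed point is the required preimage of
  \<open>p\<close>.\<close>

lemma strongly_monotone_lipschitz_surj:
  fixes F :: "'a::{real_inner,complete_space} \<Rightarrow> 'a"
  assumes F: "strongly_monotone_lipschitz \<mu> L F" and "\<mu> > 0" "L > 0"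
  obtains x where "F x = p"
proof -
  define \<tau> where "\<tau> = \<mu> / L\<^sup>2"
  \<comment> \<open>The truncation at 0 avoids having to know \<mu> \<le> L, which can fail in the
    zero space.\<close>
  define q where "q = sqrt (max 0 (1 - \<mu>\<^sup>2 / L\<^sup>2))"
  have \<tau>: "\<tau> > 0" using assms by (simp add: \<tau>_def)
  have q: "0 \<le> q" "q < 1" "1 - \<mu>\<^sup>2 / L\<^sup>2 \<le> q\<^sup>2" using assms by (auto simp: q_def)
  let ?T = "\<lambda>x. x - \<tau> *\<^sub>R (F x - p)"
  have "dist (?T x) (?T y) \<le> q * dist x y" for x y
  proof -
    define D G where "D = x - y" and "G = F x - F y"
    have m: "\<mu> * (norm D)\<^sup>2 \<le> G \<bullet> D" and l: "norm G \<le> L * norm D"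
      using F by (auto simp: strongly_monotone_lipschitz_def D_def G_def)
    have "(norm G)\<^sup>2 \<le> L\<^sup>2 * (norm D)\<^sup>2"
      using power_mono[OF l norm_ge_zero, of 2] by (simp add: power_mult_distrib)
    then have "\<tau>\<^sup>2 * (norm G)\<^sup>2 \<le> \<tau>\<^sup>2 * (L\<^sup>2 * (norm D)\<^sup>2)"
      by (intro mult_left_mono) auto
    moreover have "2 * \<tau> * (\<mu> * (norm D)\<^sup>2) \<le> 2 * \<tau> * (G \<bullet> D)"
      using m \<tau> by (intro mult_left_mono) auto
    moreover have "(norm (D - \<tau> *\<^sub>R G))\<^sup>2 = (norm D)\<^sup>2 - 2 * \<tau> * (G \<bullet> D) + \<tau>\<^sup>2 * (norm G)\<^sup>2"
      unfolding power2_norm_eq_inner inner_diff_left inner_diff_right inner_scaleR_left inner_scaleR_right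
        inner_commute[of D G] by (simp add: power2_eq_square) algebra
    ultimately have "(norm (D - \<tau> *\<^sub>R G))\<^sup>2 \<le> (1 - 2 * \<tau> * \<mu> + \<tau>\<^sup>2 * L\<^sup>2) * (norm D)\<^sup>2"
      by (simp add: algebra_simps)
    also have "1 - 2 * \<tau> * \<mu> + \<tau>\<^sup>2 * L\<^sup>2 = 1 - \<mu>\<^sup>2 / L\<^sup>2"
      using \<open>L > 0\<close> by (simp add: \<tau>_def field_simps power2_eq_square)
    also have "(1 - \<mu>\<^sup>2 / L\<^sup>2) * (norm D)\<^sup>2 \<le> q\<^sup>2 * (norm D)\<^sup>2"
      using q by (intro mult_right_mono) auto
    finally have "(norm (D - \<tau> *\<^sub>R G))\<^sup>2 \<le> (q * norm D)\<^sup>2" by (simp add: power_mult_distrib)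
    then have "norm (D - \<tau> *\<^sub>R G) \<le> q * norm D"
      using q(1) by (rule power2_le_imp_le[OF _ mult_nonneg_nonneg]) simp
    moreover have "?T x - ?T y = D - \<tau> *\<^sub>R G" by (simp add: D_def G_def scaleR_diff_right)
    ultimately show ?thesis by (simp only: dist_norm D_def)
  qed
  then obtain x where "?T x = x" using banach_fix_type[of q ?T] q by blast
  with \<tau> have "F x = p" by simp
  then show thesis by (rule that)
qed

text \<open>With U = u + \<rho> g and V = u - \<rho> g, cocoercivity reads (p U - V) . (V - q U)
  \<ge> 0, where p and q are the quotients belonging to \<epsilon> and M. By Thales, V lies in the
  ball with diameter from p U to q U, so |V| is at most (|p - q| + |p + q|) / 2 = max |p| |q| times
  |U|.\<close>

lemma norm_reflection_le:
  fixes u a :: "'a::real_inner"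
  assumes coco: "(norm a)\<^sup>2 \<le> \<beta> * (u \<bullet> a)" and pos: "\<beta> > 0" "\<epsilon> > 0" "\<rho> > 0"
  defines "M \<equiv> \<epsilon> + \<beta>" and "g \<equiv> \<epsilon> *\<^sub>R u + a"
  shows "norm (u - \<rho> *\<^sub>R g)
    \<le> max \<bar>(1 - \<rho> * M) / (1 + \<rho> * M)\<bar> \<bar>(1 - \<rho> * \<epsilon>) / (1 + \<rho> * \<epsilon>)\<bar> * norm (u + \<rho> *\<^sub>R g)"
proof -
  define U V where "U = u + \<rho> *\<^sub>R g" and "V = u - \<rho> *\<^sub>R g"
  define m1 M1 where "m1 = 1 + \<rho> * \<epsilon>" and "M1 = 1 + \<rho> * M"
  have m1: "m1 > 0" and M1: "M1 > 0" using pos by (auto simp: m1_def M1_def M_def add_pos_pos)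
  define p q where "p = (1 - \<rho> * \<epsilon>) / m1" and "q = (1 - \<rho> * M) / M1"
  have mp: "m1 * p = 1 - \<rho> * \<epsilon>" and Mq: "M1 * q = 1 - \<rho> * M"
    using m1 M1 by (simp_all add: p_def q_def)
  have u: "u = (1/2) *\<^sub>R (U + V)" and g: "\<rho> *\<^sub>R g = (1/2) *\<^sub>R (U - V)"
    by (simp_all add: U_def V_def scaleR_left_distrib[symmetric])
  have a: "\<rho> *\<^sub>R a = \<rho> *\<^sub>R g - (\<rho> * \<epsilon>) *\<^sub>R u" by (simp add: g_def algebra_simps)
  have "2 *\<^sub>R (\<rho> *\<^sub>R a) = (1 - \<rho> * \<epsilon>) *\<^sub>R U - (1 + \<rho> * \<epsilon>) *\<^sub>R V"
    unfolding a g by (subst u) (simp add: algebra_simps)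
  also have "\<dots> = m1 *\<^sub>R (p *\<^sub>R U - V)"
    unfolding scaleR_diff_right scaleR_scaleR mp by (simp add: m1_def)
  finally have a1: "2 *\<^sub>R (\<rho> *\<^sub>R a) = m1 *\<^sub>R (p *\<^sub>R U - V)" .
  have "2 *\<^sub>R (\<rho> *\<^sub>R (\<beta> *\<^sub>R u - a)) = (2 * \<rho> * M) *\<^sub>R u - 2 *\<^sub>R (\<rho> *\<^sub>R g)"
    by (simp add: g_def M_def algebra_simps)
  also have "\<dots> = (\<rho> * M - 1) *\<^sub>R U + (1 + \<rho> * M) *\<^sub>R V"
    unfolding g by (subst u) (simp add: algebra_simps)
  also have "\<dots> = M1 *\<^sub>R (V - q *\<^sub>R U)"
    unfolding scaleR_diff_right scaleR_scaleR Mq by (simp add: M1_def algebra_simps)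
  finally have a2: "2 *\<^sub>R (\<rho> *\<^sub>R (\<beta> *\<^sub>R u - a)) = M1 *\<^sub>R (V - q *\<^sub>R U)" .
  have "0 \<le> 4 * \<rho>\<^sup>2 * (a \<bullet> (\<beta> *\<^sub>R u - a))"
    using coco by (simp add: inner_diff_right power2_norm_eq_inner inner_commute)
  also have "\<dots> = (2 *\<^sub>R (\<rho> *\<^sub>R a)) \<bullet> (2 *\<^sub>R (\<rho> *\<^sub>R (\<beta> *\<^sub>R u - a)))"
    by (simp add: power2_eq_square)
  also have "\<dots> = (m1 * M1) * ((p *\<^sub>R U - V) \<bullet> (V - q *\<^sub>R U))"
    unfolding a1 a2 by simp
  finally have key: "0 \<le> (p *\<^sub>R U - V) \<bullet> (V - q *\<^sub>R U)"
    using mult_le_cancel_left_pos[OF mult_pos_pos[OF m1 M1], of 0] by simp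
  have "(norm (V - ((p + q) / 2) *\<^sub>R U))\<^sup>2 
      = ((p - q) / 2)\<^sup>2 * (norm U)\<^sup>2 - (p *\<^sub>R U - V) \<bullet> (V - q *\<^sub>R U)"
    unfolding power2_norm_eq_inner inner_diff_left inner_diff_right inner_scaleR_left inner_scaleR_right
      inner_commute[of U V] by (simp add: power2_eq_square field_simps)
  also have "\<dots> \<le> (\<bar>p - q\<bar> / 2 * norm U)\<^sup>2" 
    using key by (simp add: power_mult_distrib power_divide)
  finally have "norm (V - ((p + q) / 2) *\<^sub>R U) \<le> \<bar>p - q\<bar> / 2 * norm U"
    by (rule power2_le_imp_le) auto
  moreover have "norm V \<le> norm (V - ((p + q) / 2) *\<^sub>R U) + norm (((p + q) / 2) *\<^sub>R U)"
    by (metis diff_add_cancel norm_triangle_ineq)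
  ultimately have "norm V \<le> (\<bar>p - q\<bar> / 2 + \<bar>p + q\<bar> / 2) * norm U"
    by (simp add: algebra_simps)
  also have "\<bar>p - q\<bar> / 2 + \<bar>p + q\<bar> / 2 = max \<bar>q\<bar> \<bar>p\<bar>"
    by (auto simp: max_def abs_if field_simps)
  finally show ?thesis unfolding U_def V_def p_def q_def m1_def M1_def .
qed

section \<open>The abstract consensus dual and its reflected iteration\<close>

locale consensus_dual =
  fixes A :: "'x::euclidean_space \<Rightarrow> 'w::euclidean_space" and P :: "'w \<Rightarrow> 'w" and \<mu> L d :: real
  assumes linear_A: "linear A" and linear_P: "linear P"
    and P_P: "P (P w) = w" and P_inner: "P u \<bullet> v = u \<bullet> P v"
    and norm_A: "norm (A x) \<le> sqrt d * norm x"
    and mu_pos: "\<mu> > 0" and L_pos: "L > 0" and d_pos: "d > 0"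
begin

abbreviation "regular \<equiv> strongly_monotone_lipschitz \<mu> L"

text \<open>If \<open>F = \<nabla>f\<close>, then \<open>dual_pair F w x\<close> says that \<open>A x\<close> is the gradient of
  \<open>f\<^sup>\<star> \<circ> A\<^sup>T\<close> at \<open>w\<close>.\<close>

definition dual_pair :: "('x \<Rightarrow> 'x) \<Rightarrow> 'w \<Rightarrow> 'x \<Rightarrow> bool" where
  "dual_pair F w x \<longleftrightarrow> F x = adjoint A w"

text \<open>As \<open>P\<close> is a self-adjoint involution, symmetric and antisymmetric vectors
  are orthogonal complements. For a gradient \<open>F\<close> of f this is thus the optimality
  condition of \<epsilon>/2 |w|^2 + f*(A^T w) over antisymmetric \<open>w\<close>: the dual gradient
  has no antisymmetric part. At \<epsilon> = 0 it is the optimality system of the consensus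
  problem.\<close>

definition dual_opt :: "real \<Rightarrow> ('x \<Rightarrow> 'x) \<Rightarrow> 'w \<Rightarrow> 'x \<Rightarrow> bool" where
  "dual_opt \<epsilon> F w x \<longleftrightarrow>
     dual_pair F w x \<and> P w = - w \<and> P (\<epsilon> *\<^sub>R w + A x) = \<epsilon> *\<^sub>R w + A x"

definition lift :: "real \<Rightarrow> real \<Rightarrow> 'w \<Rightarrow> 'x \<Rightarrow> 'w" where
  "lift \<epsilon> \<rho> w x = w + \<rho> *\<^sub>R (\<epsilon> *\<^sub>R w + A x)"

lemma A_diff: "A (x - y) = A x - A y" using linear_A by (rule linear_diff)
lemma P_add: "P (x + y) = P x + P y" using linear_P by (rule linear_add)
lemma P_diff: "P (x - y) = P x - P y" using linear_P by (rule linear_diff)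
lemma P_scaleR: "P (c *\<^sub>R x) = c *\<^sub>R P x" using linear_P by (rule linear_scale)
lemma P_minus: "P (- x) = - P x" using linear_P by (rule linear_neg)
lemma norm_P: "norm (P w) = norm w" by (simp add: norm_eq_sqrt_inner P_inner P_P)
lemma adjoint_diff: "adjoint A (x - y) = adjoint A x - adjoint A y"
  using adjoint_linear[OF linear_A] by (rule linear_diff)
lemma inner_adjoint: "adjoint A w \<bullet> x = w \<bullet> A x"
  using adjoint_works[OF linear_A] by (simp add: inner_commute)

lemma inner_antisym_sym:
  assumes "P u = - u" "P v = v" shows "u \<bullet> v = 0"
  using P_inner[of u v] assms by simp

lemma dual_pair_exists:
  assumes "regular F" obtains x where "dual_pair F w x"
  using strongly_monotone_lipschitz_surj[OF assms mu_pos L_pos, of "adjoint A w"]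
  by (auto simp: dual_pair_def)

lemma dual_pair_mono:
  assumes "regular F" "dual_pair F w1 x1" "dual_pair F w2 x2"
  shows "\<mu> * (norm (x1 - x2))\<^sup>2 \<le> (w1 - w2) \<bullet> (A x1 - A x2)"
proof -
  have "\<mu> * (norm (x1 - x2))\<^sup>2 \<le> (F x1 - F x2) \<bullet> (x1 - x2)"
    using assms(1) by (auto simp: strongly_monotone_lipschitz_def)
  also have "\<dots> = (w1 - w2) \<bullet> (A x1 - A x2)"
    using assms(2,3) by (simp add: dual_pair_def adjoint_diff[symmetric] inner_adjoint A_diff)
  finally show ?thesis .
qed

lemma norm_A_diff_sq: "(norm (A x - A y))\<^sup>2 \<le> d * (norm (x - y))\<^sup>2"
  using power_mono[OF norm_A[of "x - y"] norm_ge_zero, of 2] d_pos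
  by (simp add: A_diff power_mult_distrib)

text \<open>Strong convexity makes the conjugate smooth with constant 1 / \<mu>, and composing with
  A multiplies this by \<open>d\<close>. The cocoercive form is the one that
  \<open>norm_reflection_le\<close> consumes.\<close>

lemma dual_pair_cocoercive:
  assumes "regular F" "dual_pair F w1 x1" "dual_pair F w2 x2"
  shows "(norm (A x1 - A x2))\<^sup>2 \<le> d / \<mu> * ((w1 - w2) \<bullet> (A x1 - A x2))"
proof -
  have "(norm (A x1 - A x2))\<^sup>2 \<le> d / \<mu> * (\<mu> * (norm (x1 - x2))\<^sup>2)"
    using norm_A_diff_sq[of x1 x2] mu_pos by simp
  also have "\<dots> \<le> d / \<mu> * ((w1 - w2) \<bullet> (A x1 - A x2))"
    using dual_pair_mono[OF assms] mu_pos d_pos by (intro mult_left_mono) auto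
  finally show ?thesis .
qed

lemma dual_pair_lipschitz:
  assumes "regular F" "dual_pair F w1 x1" "dual_pair F w2 x2"
  shows "norm (A x1 - A x2) \<le> d / \<mu> * norm (w1 - w2)"
proof (cases "norm (A x1 - A x2) = 0")
  case False
  have "norm (A x1 - A x2) * norm (A x1 - A x2) \<le> d / \<mu> * ((w1 - w2) \<bullet> (A x1 - A x2))"
    using dual_pair_cocoercive[OF assms] by (simp add: power2_eq_square)
  also have "\<dots> \<le> d / \<mu> * (norm (w1 - w2) * norm (A x1 - A x2))"
    using mu_pos d_pos by (intro mult_left_mono norm_cauchy_schwarz) auto
  finally have "norm (A x1 - A x2) * norm (A x1 - A x2) \<le> (d / \<mu> * norm (w1 - w2)) * norm (A x1 - A x2)"
    by (simp add: mult.assoc)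
  then show ?thesis using False by (simp only: mult_le_cancel_right) auto
qed (use mu_pos d_pos in auto)

text \<open>At a common \<open>w\<close> the two gradients agree, F x = F' x', so strong
  monotonicity of \<open>F'\<close> turns a gradient gap into a distance. Only the gap at
  \<open>x\<close> enters, which admits predicted costs, whose gradients are controlled at the
  expansion point only.\<close>

lemma dual_pair_drift:
  assumes F: "regular F" and F': "regular F'" and "dual_pair F w x" "dual_pair F' w x'"
    and b: "norm (F x - F' x) \<le> b"
  shows "norm (A x - A x') \<le> sqrt d * b / \<mu>"
proof -
  have eq: "F x = F' x'" using assms by (simp add: dual_pair_def)
  have "\<mu> * (norm (x - x'))\<^sup>2 \<le> (F' x - F' x') \<bullet> (x - x')"
    using F' by (auto simp: strongly_monotone_lipschitz_def)
  also have "\<dots> \<le> norm (F' x - F' x') * norm (x - x')" by (rule norm_cauchy_schwarz)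
  also have "\<dots> \<le> b * norm (x - x')"
    using b eq by (intro mult_right_mono) (auto simp: norm_minus_commute)
  finally have "\<mu> * norm (x - x') * norm (x - x') \<le> b * norm (x - x')"
    by (simp add: power2_eq_square mult.assoc)
  then have "\<mu> * norm (x - x') \<le> b \<or> x = x'" by (auto simp: mult_le_cancel_right)
  moreover have "0 \<le> b" using b norm_ge_zero order_trans by blast
  ultimately have "\<mu> * norm (x - x') \<le> b" by auto
  then have "norm (x - x') \<le> b / \<mu>" using mu_pos by (simp add: field_simps)
  then have "sqrt d * norm (x - x') \<le> sqrt d * (b / \<mu>)" using d_pos by (intro mult_left_mono) auto
  then show ?thesis using norm_A[of "x - x'"] by (simp add: A_diff)
qed

lemma lift_diff:
  "lift \<epsilon> \<rho> w1 x1 - lift \<epsilon> \<rho> w2 x2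
     = (w1 - w2) + \<rho> *\<^sub>R (\<epsilon> *\<^sub>R (w1 - w2) + (A x1 - A x2))"
  by (simp add: lift_def algebra_simps)

lemma lift_step_contraction:
  assumes F: "regular F" "dual_pair F w1 x1" "dual_pair F w2 x2" and "\<epsilon> > 0" "\<rho> > 0"
  shows "norm ((2 *\<^sub>R w1 - lift \<epsilon> \<rho> w1 x1) - (2 *\<^sub>R w2 - lift \<epsilon> \<rho> w2 x2))
    \<le> rate d \<mu> \<rho> \<epsilon> * norm (lift \<epsilon> \<rho> w1 x1 - lift \<epsilon> \<rho> w2 x2)"
proof -
  have "(2 *\<^sub>R w1 - lift \<epsilon> \<rho> w1 x1) - (2 *\<^sub>R w2 - lift \<epsilon> \<rho> w2 x2)
    = (w1 - w2) - \<rho> *\<^sub>R (\<epsilon> *\<^sub>R (w1 - w2) + (A x1 - A x2))"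
    by (simp add: lift_def algebra_simps scaleR_2)
  then show ?thesis
    using norm_reflection_le[OF dual_pair_cocoercive[OF F], of \<epsilon> \<rho>] assms mu_pos d_pos
    by (simp add: lift_diff rate_def L_bar_def mu_bar_def)
qed

text \<open>The resolvent of an \<epsilon>-strongly monotone operator contracts by 1 / (1 + \<rho>
  \<epsilon>). This brings estimates in \<open>z\<close> back to \<open>w\<close>.\<close>

lemma norm_le_lift:
  assumes F: "regular F" "dual_pair F w1 x1" "dual_pair F w2 x2" and "\<epsilon> > 0" "\<rho> > 0"
  shows "(1 + \<rho> * \<epsilon>) * norm (w1 - w2) \<le> norm (lift \<epsilon> \<rho> w1 x1 - lift \<epsilon> \<rho> w2 x2)"
proof -
  define u a where "u = w1 - w2" and "a = A x1 - A x2"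
  define U where "U = lift \<epsilon> \<rho> w1 x1 - lift \<epsilon> \<rho> w2 x2"
  have U: "U = u + \<rho> *\<^sub>R (\<epsilon> *\<^sub>R u + a)" by (simp add: U_def lift_diff u_def a_def)
  have "0 \<le> u \<bullet> a" using order_trans[OF _ dual_pair_mono[OF F]] mu_pos by (simp add: u_def a_def)
  then have "(1 + \<rho> * \<epsilon>) * (norm u)\<^sup>2 \<le> u \<bullet> U"
    using assms by (simp add: U power2_norm_eq_inner algebra_simps)
  also have "\<dots> \<le> norm u * norm U" by (rule norm_cauchy_schwarz)
  finally have "(1 + \<rho> * \<epsilon>) * norm u * norm u \<le> norm U * norm u"
    by (simp add: power2_eq_square algebra_simps)
  then have "(1 + \<rho> * \<epsilon>) * norm u \<le> norm U" by (cases "u = 0") (auto simp: mult_le_cancel_right)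
  then show ?thesis by (simp add: U_def u_def)
qed

text \<open>The passage from \<open>w\<close> to \<open>z\<close>. The two pairs may belong to
  different costs: \<open>x'\<close> is the partner of \<open>w2\<close> under the cost of the first
  pair, and the last term pays for the change of cost.\<close>

lemma norm_lift_le:
  assumes F: "regular F1" "dual_pair F1 w1 x1" "dual_pair F1 w2 x'" and pos: "\<epsilon> > 0" "\<rho> > 0"
  shows "norm (lift \<epsilon> \<rho> w1 x1 - lift \<epsilon> \<rho> w2 x2)
    \<le> (1 + \<rho> * L_bar d \<mu> \<epsilon>) * norm (w1 - w2) + \<rho> * norm (A x' - A x2)"
proof -
  have "lift \<epsilon> \<rho> w1 x1 - lift \<epsilon> \<rho> w2 x2
      = (1 + \<rho> * \<epsilon>) *\<^sub>R (w1 - w2) + \<rho> *\<^sub>R (A x1 - A x') + \<rho> *\<^sub>R (A x' - A x2)"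
    by (simp add: lift_def algebra_simps)
  also have "norm \<dots> \<le> norm ((1 + \<rho> * \<epsilon>) *\<^sub>R (w1 - w2)) + norm (\<rho> *\<^sub>R (A x1 - A x'))
      + norm (\<rho> *\<^sub>R (A x' - A x2))"
    by (meson norm_triangle_ineq norm_triangle_mono order_refl order_trans)
  also have "\<dots> = (1 + \<rho> * \<epsilon>) * norm (w1 - w2) + \<rho> * norm (A x1 - A x') + \<rho> * norm (A x' - A x2)"
    using pos by simp
  also have "\<dots> \<le> (1 + \<rho> * \<epsilon>) * norm (w1 - w2) + \<rho> * (d / \<mu> * norm (w1 - w2)) + \<rho> * norm (A x' - A x2)"
    using dual_pair_lipschitz[OF F] pos by (intro add_mono mult_left_mono) auto
  finally show ?thesis by (simp add: L_bar_def algebra_simps)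
qed

text \<open>The map - P fixes the antisymmetric \<open>w\<close> and reverses the sign of the
  symmetric gradient g, so it sends w - \<rho> g to w + \<rho> g.\<close>

lemma dual_opt_fixed_point:
  assumes "dual_opt \<epsilon> F w x"
  shows "- P (2 *\<^sub>R w - lift \<epsilon> \<rho> w x) = lift \<epsilon> \<rho> w x"
proof -
  have "2 *\<^sub>R w - lift \<epsilon> \<rho> w x = w - \<rho> *\<^sub>R (\<epsilon> *\<^sub>R w + A x)" by (simp add: lift_def scaleR_2)
  then have "- P (2 *\<^sub>R w - lift \<epsilon> \<rho> w x) = - P w + \<rho> *\<^sub>R P (\<epsilon> *\<^sub>R w + A x)"
    by (simp only: P_diff P_scaleR) simp
  then show ?thesis using assms by (simp add: dual_opt_def lift_def)
qed

text \<open>\<open>V\<close> will be the edge space: the ADMM step annihilates all blocks off the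
  graph and is identified with the reflection step only on this invariant set.\<close>

lemma iterate_contraction:
  assumes F: "regular F" and pos: "\<epsilon> > 0" "\<rho> > 0" and opt: "dual_opt \<epsilon> F ws xs"
    and T: "\<And>z. z \<in> V \<Longrightarrow> T z \<in> V \<and>
      (\<exists>w x. dual_pair F w x \<and> lift \<epsilon> \<rho> w x = z \<and> T z = - P (2 *\<^sub>R w - z))"
    and "z \<in> V"
  shows "norm ((T ^^ n) z - lift \<epsilon> \<rho> ws xs) \<le> rate d \<mu> \<rho> \<epsilon> ^ n * norm (z - lift \<epsilon> \<rho> ws xs)"
    and "(T ^^ n) z \<in> V"
proof -
  let ?l = "lift \<epsilon> \<rho> ws xs"
  have r: "rate d \<mu> \<rho> \<epsilon> \<ge> 0" unfolding rate_def by (rule max.coboundedI1) simp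
  have step: "norm (T z - ?l) \<le> rate d \<mu> \<rho> \<epsilon> * norm (z - ?l)" if z: "z \<in> V" for z
  proof -
    obtain w x where w: "dual_pair F w x" "lift \<epsilon> \<rho> w x = z" "T z = - P (2 *\<^sub>R w - z)"
      using T[OF z] by blast
    have "T z - ?l = - P ((2 *\<^sub>R w - z) - (2 *\<^sub>R ws - ?l))"
      using dual_opt_fixed_point[OF opt, of \<rho>] w(3) P_diff[of "2 *\<^sub>R w - z" "2 *\<^sub>R ws - ?l"]
      by (metis minus_diff_minus)
    then have "norm (T z - ?l) = norm ((2 *\<^sub>R w - z) - (2 *\<^sub>R ws - ?l))" by (simp add: norm_P)
    also have "\<dots> \<le> rate d \<mu> \<rho> \<epsilon> * norm (z - ?l)"
      using lift_step_contraction[OF F w(1), of ws xs \<epsilon> \<rho>] opt pos w(2) by (simp add: dual_opt_def)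
    finally show ?thesis .
  qed
  have "(T ^^ n) z \<in> V \<and> norm ((T ^^ n) z - ?l) \<le> rate d \<mu> \<rho> \<epsilon> ^ n * norm (z - ?l)"
  proof (induction n)
    case 0
    then show ?case using \<open>z \<in> V\<close> by simp
  next
    case (Suc n)
    then have "norm (T ((T ^^ n) z) - ?l) \<le> rate d \<mu> \<rho> \<epsilon> * norm ((T ^^ n) z - ?l)"
      using step by blast
    also have "\<dots> \<le> rate d \<mu> \<rho> \<epsilon> * (rate d \<mu> \<rho> \<epsilon> ^ n * norm (z - ?l))"
      using Suc r by (intro mult_left_mono) auto
    finally have "norm (T ((T ^^ n) z) - ?l) \<le> rate d \<mu> \<rho> \<epsilon> * (rate d \<mu> \<rho> \<epsilon> ^ n * norm (z - ?l))" .
    then show ?case using Suc T by (simp add: mult.assoc)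
  qed
  then show "norm ((T ^^ n) z - ?l) \<le> rate d \<mu> \<rho> \<epsilon> ^ n * norm (z - ?l)" "(T ^^ n) z \<in> V" by auto
qed

text \<open>With \<open>pr\<close> the orthogonal projection onto the antisymmetric vectors,
  \<open>G\<close> is strongly monotone and Lipschitz on the whole space and so has a zero. The term
  \<epsilon> w forces this zero into the range of \<open>pr\<close>, which makes it
  feasible.\<close>

lemma dual_opt_exists:
  assumes F: "regular F" and "\<epsilon> > 0"
  obtains w x where "dual_opt \<epsilon> F w x"
proof -
  define pr where "pr w = (1/2) *\<^sub>R (w - P w)" for w
  define X where "X w = (SOME x. dual_pair F w x)" for w
  have X: "dual_pair F w (X w)" for w
    unfolding X_def using dual_pair_exists[OF F, of w] by (metis someI_ex)
  define G where "G w = \<epsilon> *\<^sub>R w + pr (A (X (pr w)))" for w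
  have Ppr: "P (pr w) = - pr w" for w by (simp add: pr_def P_scaleR P_diff P_P algebra_simps)
  have pr_diff: "pr (u - v) = pr u - pr v" for u v by (simp add: pr_def P_diff algebra_simps)
  have pr_inner: "pr u \<bullet> v = u \<bullet> pr v" for u v
    by (simp add: pr_def P_inner inner_diff_left inner_diff_right)
  have npr: "norm (pr u) \<le> norm u" for u
    using norm_triangle_ineq4[of u "P u"] by (simp add: pr_def norm_P)
  have "strongly_monotone_lipschitz \<epsilon> (\<epsilon> + d / \<mu>) G"
    unfolding strongly_monotone_lipschitz_def
  proof (intro conjI allI)
    fix u v
    define a where "a = A (X (pr u)) - A (X (pr v))"
    have G: "G u - G v = \<epsilon> *\<^sub>R (u - v) + pr a" by (simp add: G_def a_def pr_diff algebra_simps)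
    have "0 \<le> (pr u - pr v) \<bullet> a"
      using order_trans[OF _ dual_pair_mono[OF F X X]] mu_pos by (simp add: a_def)
    then have "0 \<le> pr a \<bullet> (u - v)" by (simp add: pr_inner pr_diff inner_commute)
    then show "\<epsilon> * (norm (u - v))\<^sup>2 \<le> (G u - G v) \<bullet> (u - v)"
      unfolding G inner_add_left by (simp add: power2_norm_eq_inner)
    have "norm a \<le> d / \<mu> * norm (pr (u - v))"
      using dual_pair_lipschitz[OF F X X] by (simp add: a_def pr_diff)
    also have "\<dots> \<le> d / \<mu> * norm (u - v)" using npr mu_pos d_pos by (intro mult_left_mono) auto
    finally have "norm (pr a) \<le> d / \<mu> * norm (u - v)" using npr order_trans by blast
    moreover have "norm (G u - G v) \<le> \<epsilon> * norm (u - v) + norm (pr a)"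
      unfolding G using norm_triangle_ineq[of "\<epsilon> *\<^sub>R (u - v)" "pr a"] \<open>\<epsilon> > 0\<close> by simp
    ultimately show "norm (G u - G v) \<le> (\<epsilon> + d / \<mu>) * norm (u - v)" by (simp add: algebra_simps)
  qed
  then obtain w where w: "G w = 0"
    using strongly_monotone_lipschitz_surj[of \<epsilon> _ G 0] \<open>\<epsilon> > 0\<close> mu_pos d_pos
    by (metis add_pos_pos divide_pos_pos)
  then have e: "\<epsilon> *\<^sub>R w = - pr (A (X (pr w)))" by (simp add: G_def eq_neg_iff_add_eq_0)
  then have "\<epsilon> *\<^sub>R P w = \<epsilon> *\<^sub>R (- w)" by (metis P_minus P_scaleR Ppr scaleR_minus_right)
  then have Pw: "P w = - w" using \<open>\<epsilon> > 0\<close> by (simp only: scaleR_cancel_left) simp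
  then have prw: "pr w = w" by (simp add: pr_def scaleR_2[symmetric])
  have half: "- ((1/2) *\<^sub>R (a - b)) + a = (1/2) *\<^sub>R (a + b)" for a b :: 'w
  proof -
    have "(1/2) *\<^sub>R (a + b) + (1/2) *\<^sub>R (a - b) = (1/2) *\<^sub>R (a + a)"
      unfolding scaleR_add_right[symmetric] by simp
    moreover have "u + v = a \<Longrightarrow> - v + a = u" for u v :: 'w by auto
    ultimately show ?thesis by (simp only: scaleR_half_double)
  qed
  have "P (\<epsilon> *\<^sub>R w + A (X w)) = \<epsilon> *\<^sub>R w + A (X w)"
  proof -
    have "\<epsilon> *\<^sub>R w + A (X w) = (1/2) *\<^sub>R (A (X w) + P (A (X w)))"
      unfolding e prw unfolding pr_def by (rule half)
    then show ?thesis by (simp add: P_scaleR P_add P_P add.commute)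
  qed
  then show thesis using that[of w "X w"] X Pw by (simp add: dual_opt_def)
qed

text \<open>A strong monotonicity constant that does not depend on \<open>\<epsilon>\<close>: the map \<open>A\<^sup>T\<close> is injective on
  the range of \<open>A - P A\<close>, and this range contains all regularized dual solutions.\<close>

lemma uniform_gap:
  obtains c where "c > 0"
    "\<And>F w1 x1 w2 x2. \<lbrakk>regular F; dual_pair F w1 x1; dual_pair F w2 x2;
       w1 - w2 \<in> range (\<lambda>x. A x - P (A x))\<rbrakk> \<Longrightarrow>
       c * (norm (w1 - w2))\<^sup>2 \<le> (w1 - w2) \<bullet> (A x1 - A x2)"
proof -
  define R where "R = range (\<lambda>x. A x - P (A x))"
  have lin: "linear (\<lambda>x. A x - P (A x))"
    using linear_A linear_P linear_compose_sub linear_compose[of A P, unfolded o_def] by blast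
  have sub: "subspace R" unfolding R_def by (intro linear_subspace_image lin subspace_UNIV)
  \<comment> \<open>A vector in the kernel of A^T is orthogonal to the range of A. Being
    antisymmetric, it is then orthogonal to P (A x) as well, hence to itself.\<close>
  have "w = 0" if "w \<in> R" "adjoint A w = 0" for w
  proof -
    obtain x where x: "w = A x - P (A x)" using \<open>w \<in> R\<close> by (auto simp: R_def)
    have "w \<bullet> A x = 0" using inner_adjoint[of w x] that by simp
    moreover have "w \<bullet> P (A x) = - (w \<bullet> A x)"
      using x P_inner[of w "A x"] by (simp add: P_diff P_P inner_diff_left)
    ultimately have "w \<bullet> w = 0" by (subst (2) x) (simp add: inner_diff_right)
    then show ?thesis by simp
  qed
  then obtain s where s: "s > 0" "\<And>w. w \<in> R \<Longrightarrow> s * norm w \<le> norm (adjoint A w)"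
    using injective_imp_isometric[OF closed_subspace[OF sub] sub, of "adjoint A"]
      adjoint_linear[OF linear_A] linear_conv_bounded_linear by (metis (no_types))
  \<comment> \<open>Here \<open>s\<close> bounds A^T from below on \<open>R\<close>. The constant
    involves A, P, \<mu> and L only, so it serves all regular costs at once.\<close>
  show thesis
  proof (rule that[of "\<mu> * (s / L)\<^sup>2"])
    show "\<mu> * (s / L)\<^sup>2 > 0" using mu_pos L_pos s by simp
    fix F w1 x1 w2 x2
    assume F: "regular F" and 1: "dual_pair F w1 x1" and 2: "dual_pair F w2 x2"
      and r: "w1 - w2 \<in> range (\<lambda>x. A x - P (A x))"
    have "s * norm (w1 - w2) \<le> norm (F x1 - F x2)"
      using s(2)[of "w1 - w2"] r 1 2 by (simp add: R_def dual_pair_def adjoint_diff)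
    also have "\<dots> \<le> L * norm (x1 - x2)" using F by (simp add: strongly_monotone_lipschitz_def)
    finally have "s / L * norm (w1 - w2) \<le> norm (x1 - x2)" using L_pos by (simp add: field_simps)
    then have "(s / L * norm (w1 - w2))\<^sup>2 \<le> (norm (x1 - x2))\<^sup>2"
      using s L_pos by (intro power_mono) auto
    then have "\<mu> * (s / L * norm (w1 - w2))\<^sup>2 \<le> \<mu> * (norm (x1 - x2))\<^sup>2"
      using mu_pos by (intro mult_left_mono) auto
    also have "\<dots> \<le> (w1 - w2) \<bullet> (A x1 - A x2)" by (rule dual_pair_mono[OF F 1 2])
    finally show "\<mu> * (s / L)\<^sup>2 * (norm (w1 - w2))\<^sup>2 \<le> (w1 - w2) \<bullet> (A x1 - A x2)"
      by (simp only: power_mult_distrib mult.assoc)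
  qed
qed

text \<open>Symmetry of \<epsilon> w + A x and antisymmetry of w give A x - P (A x) = - 2 \<epsilon>
  w; the factor is then absorbed into x.\<close>

lemma dual_opt_range:
  assumes "dual_opt \<epsilon> F w x" "\<epsilon> > 0"
  shows "w \<in> range (\<lambda>x. A x - P (A x))"
proof -
  define k where "k = - 1 / (2 * \<epsilon>)"
  have "- (\<epsilon> *\<^sub>R w) + P (A x) = \<epsilon> *\<^sub>R w + A x"
    using assms(1) unfolding dual_opt_def P_add P_scaleR by (metis scaleR_minus_right)
  moreover have "- e + p = e + a \<Longrightarrow> a - p = - (e + e)" for e p a :: 'w
    by (simp add: eq_diff_eq diff_eq_eq add.commute)
  ultimately have "A x - P (A x) = - (2 *\<^sub>R (\<epsilon> *\<^sub>R w))" unfolding scaleR_2 by blast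
  then have "k *\<^sub>R (A x - P (A x)) = w" using assms(2) by (simp add: k_def)
  then have "w = A (k *\<^sub>R x) - P (A (k *\<^sub>R x))"
    by (simp add: linear_scale[OF linear_A] P_scaleR scaleR_diff_right)
  then show ?thesis by blast
qed

end

section \<open>Error estimates for one prediction-correction step and for the regularization\<close>

context consensus_dual
begin

text \<open>The difference of the two antisymmetric optima is orthogonal to the difference of their
  symmetric gradients. The \<epsilon> term has a favourable sign and is dropped, so that the drift
  is divided by \<open>c\<close> and not by \<epsilon>.\<close>

lemma dual_opt_diff_le:
  assumes gap: "\<And>w1 x1 w2 x2. \<lbrakk>dual_pair F1 w1 x1; dual_pair F1 w2 x2;
       w1 - w2 \<in> range (\<lambda>x. A x - P (A x))\<rbrakk> \<Longrightarrow>
       c * (norm (w1 - w2))\<^sup>2 \<le> (w1 - w2) \<bullet> (A x1 - A x2)"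
    and "\<epsilon> > 0" and o1: "dual_opt \<epsilon> F1 w1 x1" and o2: "dual_opt \<epsilon> F2 w2 x2"
    and x': "dual_pair F1 w2 x'"
  shows "c * norm (w1 - w2) \<le> norm (A x' - A x2)"
proof -
  obtain y1 y2 where "w1 = A y1 - P (A y1)" "w2 = A y2 - P (A y2)"
    using dual_opt_range[OF o1 \<open>\<epsilon> > 0\<close>] dual_opt_range[OF o2 \<open>\<epsilon> > 0\<close>] by auto
  then have "w1 - w2 = A (y1 - y2) - P (A (y1 - y2))" by (simp add: A_diff P_diff)
  then have g: "c * (norm (w1 - w2))\<^sup>2 \<le> (w1 - w2) \<bullet> (A x1 - A x')"
    using gap[of w1 x1 w2 x'] o1 x' by (auto simp: dual_opt_def)
  have P: "P (w1 - w2) = - (w1 - w2)" using o1 o2 by (simp add: dual_opt_def P_diff)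
  have "(w1 - w2) \<bullet> ((\<epsilon> *\<^sub>R w1 + A x1) - (\<epsilon> *\<^sub>R w2 + A x2)) = 0"
    using inner_antisym_sym[OF P, of "(\<epsilon> *\<^sub>R w1 + A x1) - (\<epsilon> *\<^sub>R w2 + A x2)"] o1 o2
    by (simp only: dual_opt_def P_diff)
  moreover have "(\<epsilon> *\<^sub>R w1 + A x1) - (\<epsilon> *\<^sub>R w2 + A x2) = \<epsilon> *\<^sub>R (w1 - w2) + (A x1 - A x2)"
    by (simp add: scaleR_diff_right)
  ultimately have "(w1 - w2) \<bullet> (A x1 - A x2) = - (\<epsilon> * (norm (w1 - w2))\<^sup>2)"
    by (simp only: inner_add_right inner_scaleR_right power2_norm_eq_inner)
  moreover have "0 \<le> \<epsilon> * (norm (w1 - w2))\<^sup>2" using \<open>\<epsilon> > 0\<close> by simp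
  moreover have "(w1 - w2) \<bullet> (A x1 - A x') = (w1 - w2) \<bullet> (A x1 - A x2) + (w1 - w2) \<bullet> (A x2 - A x')"
    by (simp add: inner_add_right[symmetric])
  ultimately have "c * (norm (w1 - w2))\<^sup>2 \<le> (w1 - w2) \<bullet> (A x2 - A x')" using g by linarith
  also have "\<dots> \<le> norm (w1 - w2) * norm (A x2 - A x')" by (rule norm_cauchy_schwarz)
  finally have "c * norm (w1 - w2) * norm (w1 - w2) \<le> norm (A x' - A x2) * norm (w1 - w2)"
    by (simp add: power2_eq_square mult_ac norm_minus_commute)
  then show ?thesis by (cases "w1 = w2") (auto simp: mult_le_cancel_right)
qed

text \<open>The suffixes 0, h, 1 refer to the current, the predicted and the next cost;
  \<open>w0\<close> and \<open>w1\<close> are the proximal points of the iterates before and after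
  the step. Errors are estimated for \<open>lift\<close> as multiples of K = 1 + \<rho>
  \<open>L_bar\<close>, and the final return to \<open>w\<close> divides by 1 + \<rho> \<epsilon>,
  which turns K into \<open>omega\<close>.\<close>

lemma prediction_correction_step:
  fixes \<epsilon> \<rho> b r C0 Ts c :: real
  assumes c: "c > 0"
    and gap: "\<And>F w1 x1 w2 x2. \<lbrakk>regular F; dual_pair F w1 x1; dual_pair F w2 x2;
       w1 - w2 \<in> range (\<lambda>x. A x - P (A x))\<rbrakk> \<Longrightarrow>
       c * (norm (w1 - w2))\<^sup>2 \<le> (w1 - w2) \<bullet> (A x1 - A x2)"
    and reg: "regular F0" "regular Fh" "regular F1"
    and pos: "\<epsilon> > 0" "\<rho> > 0"
    and o0: "dual_opt \<epsilon> F0 ws0 xs0" and oh: "dual_opt \<epsilon> Fh wsh xsh" and o1: "dual_opt \<epsilon> F1 ws1 xs1"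
    and p0: "dual_pair F0 w0 x0" and p1: "dual_pair F1 w1 x1"
    and drift: "\<And>x. norm (F0 x - F1 x) \<le> b" and drift_h: "norm (F0 x0 - Fh x0) \<le> b"
    and pred: "norm (zh - lift \<epsilon> \<rho> wsh xsh)
       \<le> rate d \<mu> \<rho> \<epsilon> ^ NP * norm (lift \<epsilon> \<rho> w0 x0 - lift \<epsilon> \<rho> wsh xsh)"
    and pred0: "NP = 0 \<Longrightarrow> zh = lift \<epsilon> \<rho> w0 x0"
    and corr: "norm (lift \<epsilon> \<rho> w1 x1 - lift \<epsilon> \<rho> ws1 xs1)
       \<le> rate d \<mu> \<rho> \<epsilon> ^ NC * norm (zh - lift \<epsilon> \<rho> ws1 xs1)"
    and NC: "NC > 0"
    and b: "sqrt d * b / \<mu> \<le> r * (C0_bar d \<mu> C0 * Ts)" and C0: "0 \<le> C0_bar d \<mu> C0 * Ts"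
    and small: "2 * r * \<epsilon> \<le> c" "2 * r * \<epsilon> \<le> d / \<mu>" "\<epsilon> * (3 * (d / \<mu>) / c + 3) \<le> d / \<mu>"
  shows "norm (w1 - ws1)
    \<le> eta1 d \<mu> \<rho> NP NC \<epsilon> * norm (w0 - ws0) + eta0 d \<mu> C0 Ts \<rho> NP NC \<epsilon>"
proof -
  define \<beta> where "\<beta> = d / \<mu>"
  define B where "B = sqrt d * b / \<mu>"
  define \<sigma> where "\<sigma> = C0_bar d \<mu> C0 * Ts / \<epsilon>"
  define e where "e = norm (w0 - ws0)"
  define K where "K = 1 + \<rho> * L_bar d \<mu> \<epsilon>"
  define l where "l = rate d \<mu> \<rho> \<epsilon>"
  define s where "s = norm (ws1 - ws0)"
  define \<kappa> where "\<kappa> = kappa_bar d \<mu> \<epsilon>"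
  have \<beta>: "\<beta> > 0" using d_pos mu_pos by (simp add: \<beta>_def)
  have K: "K = 1 + \<rho> * \<epsilon> + \<rho> * \<beta>" by (simp add: K_def L_bar_def \<beta>_def algebra_simps)
  have K\<beta>: "\<rho> * \<beta> \<le> K" and K1: "K \<ge> 1 + \<rho> * \<epsilon>" and Kp: "K > 0"
    using pos \<beta> by (auto simp: K add_pos_pos)
  have \<sigma>: "\<sigma> \<ge> 0" using C0 pos by (simp add: \<sigma>_def)
  have e: "e \<ge> 0" by (simp add: e_def)
  have l: "l \<ge> 0" unfolding l_def rate_def by (rule max.coboundedI1) simp
  \<comment> \<open>The fixed factor \<open>r\<close>, later the square root of the number of nodes,
    is absorbed by small \<epsilon>, because \<sigma> carries a factor 1 / \<epsilon>.\<close>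
  have "B \<le> r * \<epsilon> * \<sigma>" using b pos by (simp add: B_def \<sigma>_def)
  moreover have "r * \<epsilon> * \<sigma> \<le> c / 2 * \<sigma>" "r * \<epsilon> * \<sigma> \<le> \<beta> / 2 * \<sigma>"
    using small(1,2) by (auto intro!: mult_right_mono[OF _ \<sigma>] simp: \<beta>_def simp del: times_divide_eq_left)
  ultimately have Bc: "B \<le> c * \<sigma> / 2" and B\<beta>: "B \<le> \<beta> * \<sigma> / 2" by auto
  \<comment> \<open>\<kappa> grows like 1 / \<epsilon>, whereas the distance to the predicted
    optimum estimated below has the coefficient 3 \<beta> / c + 3, free of \<epsilon>.\<close>
  have \<kappa>: "3 * \<beta> / c + 3 \<le> \<kappa>" and \<kappa>0: "\<kappa> \<ge> 0"
  proof -
    have "3 * \<beta> / c + 3 \<le> \<beta> / \<epsilon>" using small(3) pos(1) unfolding \<beta>_def[symmetric]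
      by (simp only: pos_le_divide_eq mult.commute)
    moreover have "\<kappa> = 1 + \<beta> / \<epsilon>"
      using pos by (simp add: \<kappa>_def kappa_bar_def L_bar_def mu_bar_def \<beta>_def field_simps)
    ultimately show "3 * \<beta> / c + 3 \<le> \<kappa>" "\<kappa> \<ge> 0" using \<beta> pos by auto
  qed

  have q0: "dual_pair F0 ws0 xs0" and q1: "dual_pair F1 ws1 xs1" and qh: "dual_pair Fh wsh xsh"
    using o0 o1 oh by (auto simp: dual_opt_def)
  have sB: "c * s \<le> B"
  proof -
    obtain x' where x': "dual_pair F1 ws0 x'" using dual_pair_exists[OF reg(3)] by blast
    have "c * s \<le> norm (A x' - A xs0)"
      unfolding s_def by (rule dual_opt_diff_le[OF gap[OF reg(3)] pos(1) o1 o0 x'])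
    also have "\<dots> \<le> B"
      using dual_pair_drift[OF reg(1,3) q0 x' drift] by (simp add: B_def norm_minus_commute)
    finally show ?thesis .
  qed
  have s2: "s \<le> \<sigma> / 2"
  proof -
    have "c * s \<le> c * (\<sigma> / 2)" using sB Bc by simp
    then show ?thesis using c by (simp only: mult_le_cancel_left_pos)
  qed
  \<comment> \<open>One half of the bound pays for the motion of the optimum, the other half for the
    change of cost at \<open>ws0\<close>.\<close>
  have z10: "norm (lift \<epsilon> \<rho> ws0 xs0 - lift \<epsilon> \<rho> ws1 xs1) \<le> K * \<sigma>"
  proof -
    obtain x' where x': "dual_pair F1 ws0 x'" using dual_pair_exists[OF reg(3)] by blast
    have "norm (lift \<epsilon> \<rho> ws1 xs1 - lift \<epsilon> \<rho> ws0 xs0) \<le> K * s + \<rho> * norm (A x' - A xs0)"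
      unfolding K_def s_def by (rule norm_lift_le[OF reg(3) q1 x' pos])
    also have "norm (A x' - A xs0) \<le> B"
      using dual_pair_drift[OF reg(1,3) q0 x' drift] by (simp add: B_def norm_minus_commute)
    also have "B \<le> \<beta> * \<sigma> / 2" by (rule B\<beta>)
    also have "K * s \<le> K * (\<sigma> / 2)" using s2 Kp by (intro mult_left_mono) auto
    also have "\<rho> * (\<beta> * \<sigma> / 2) \<le> K * (\<sigma> / 2)"
      using mult_right_mono[OF K\<beta>, of "\<sigma> / 2"] \<sigma> by (simp add: mult.assoc)
    finally show ?thesis using pos by (simp add: norm_minus_commute)
  qed
  have z00: "norm (lift \<epsilon> \<rho> w0 x0 - lift \<epsilon> \<rho> ws0 xs0) \<le> K * e"
    using norm_lift_le[OF reg(1) p0 q0 pos, of xs0] by (simp add: K_def e_def)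
  \<comment> \<open>The predicted gradient is known to be close to the current one only at
    \<open>x0\<close>. The predicted and the next dual gradient at \<open>ws1\<close> are therefore
    compared by a detour through \<open>w0\<close>, along the points \<open>x'\<close>,
    \<open>x2\<close>, \<open>x0\<close>, \<open>x3\<close>, \<open>xs1\<close>.\<close>
  have zh1: "norm (lift \<epsilon> \<rho> wsh xsh - lift \<epsilon> \<rho> ws1 xs1) \<le> K * (\<kappa> * (e + \<sigma>))"
  proof -
    obtain x' where x': "dual_pair Fh ws1 x'" using dual_pair_exists[OF reg(2)] by blast
    obtain x2 where x2: "dual_pair Fh w0 x2" using dual_pair_exists[OF reg(2)] by blast
    obtain x3 where x3: "dual_pair F1 w0 x3" using dual_pair_exists[OF reg(3)] by blast
    have w: "norm (ws1 - w0) \<le> e + s"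
      using norm_triangle_ineq[of "ws1 - ws0" "ws0 - w0"] by (simp add: e_def s_def norm_minus_commute)
    then have \<beta>w: "\<beta> * norm (ws1 - w0) \<le> \<beta> * (e + s)" using \<beta> by (intro mult_left_mono) auto
    have "norm (A x' - A x2) \<le> \<beta> * (e + s)"
      using dual_pair_lipschitz[OF reg(2) x' x2] \<beta>w by (simp add: \<beta>_def)
    moreover have "norm (A x0 - A x2) \<le> B"
      using dual_pair_drift[OF reg(1,2) p0 x2 drift_h] by (simp add: B_def)
    moreover have "norm (A x0 - A x3) \<le> B"
      using dual_pair_drift[OF reg(1,3) p0 x3 drift] by (simp add: B_def)
    moreover have "norm (A x3 - A xs1) \<le> \<beta> * (e + s)"
      using dual_pair_lipschitz[OF reg(3) x3 q1] \<beta>w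
      by (simp add: \<beta>_def norm_minus_commute)
    moreover have "norm (A x' - A xs1) \<le> norm (A x' - A x2) + norm (A x0 - A x2)
        + norm (A x0 - A x3) + norm (A x3 - A xs1)"
    proof -
      have "A x' - A xs1 = (A x' - A x2) + (A x2 - A x0) + (A x0 - A x3) + (A x3 - A xs1)" by simp
      also have "norm \<dots> \<le> norm (A x' - A x2) + norm (A x2 - A x0) + norm (A x0 - A x3) + norm (A x3 - A xs1)"
        by (meson norm_triangle_mono order_refl)
      finally show ?thesis by (simp only: norm_minus_commute[of "A x2"])
    qed
    ultimately have "norm (A x' - A xs1) \<le> 2 * (\<beta> * (e + s)) + 2 * B" by linarith
    moreover have "\<beta> * (e + s) \<le> \<beta> * (e + \<sigma>)" using s2 \<sigma> \<beta> by (intro mult_left_mono) auto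
    moreover have "2 * B \<le> \<beta> * (e + \<sigma>)"
      using B\<beta> mult_nonneg_nonneg[OF less_imp_le[OF \<beta>] e] unfolding distrib_left by linarith
    ultimately have G: "norm (A x' - A xs1) \<le> 3 * \<beta> * (e + \<sigma>)" unfolding mult.assoc by linarith
    have "c * norm (wsh - ws1) \<le> norm (A x' - A xs1)"
      by (rule dual_opt_diff_le[OF gap[OF reg(2)] pos(1) oh o1 x'])
    also note G
    finally have D: "norm (wsh - ws1) \<le> 3 * \<beta> / c * (e + \<sigma>)"
      using c by (simp add: field_simps)
    have "norm (lift \<epsilon> \<rho> wsh xsh - lift \<epsilon> \<rho> ws1 xs1) \<le> K * norm (wsh - ws1) + \<rho> * norm (A x' - A xs1)"
      unfolding K_def by (rule norm_lift_le[OF reg(2) qh x' pos])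
    also have "\<dots> \<le> K * (3 * \<beta> / c * (e + \<sigma>)) + \<rho> * (3 * \<beta> * (e + \<sigma>))"
      using D G Kp pos by (intro add_mono mult_left_mono) auto
    also have "\<rho> * (3 * \<beta> * (e + \<sigma>)) \<le> K * (3 * (e + \<sigma>))"
      using mult_right_mono[OF K\<beta>, of "3 * (e + \<sigma>)"] e \<sigma> by (simp add: algebra_simps)
    also have "K * (3 * \<beta> / c * (e + \<sigma>)) + K * (3 * (e + \<sigma>)) = K * ((3 * \<beta> / c + 3) * (e + \<sigma>))"
      by (simp add: algebra_simps)
    also have "\<dots> \<le> K * (\<kappa> * (e + \<sigma>))"
      using \<kappa> e \<sigma> Kp by (intro mult_left_mono mult_right_mono) auto
    finally show ?thesis by simp
  qed
  define S where "S = norm (zh - lift \<epsilon> \<rho> ws1 xs1)"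
  define \<omega> where "\<omega> = omega d \<mu> \<rho> \<epsilon>"
  have \<omega>_eq: "\<omega> = K / (1 + \<rho> * \<epsilon>)" by (simp add: \<omega>_def omega_def K_def mu_bar_def)
  have den: "1 + \<rho> * \<epsilon> > 0" using pos by (simp add: add_pos_pos)
  have \<omega>: "\<omega> \<ge> 1" unfolding \<omega>_eq using K1 den by simp
  have main: "norm (w1 - ws1) \<le> \<omega> * l ^ NC * X" if "S \<le> K * X" for X
  proof -
    have "(1 + \<rho> * \<epsilon>) * norm (w1 - ws1) \<le> norm (lift \<epsilon> \<rho> w1 x1 - lift \<epsilon> \<rho> ws1 xs1)"
      by (rule norm_le_lift[OF reg(3) p1 q1 pos])
    also have "\<dots> \<le> l ^ NC * S" using corr by (simp add: l_def S_def)
    also have "\<dots> \<le> l ^ NC * (K * X)" using that l by (intro mult_left_mono) auto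
    finally show ?thesis using den by (simp add: \<omega>_eq field_simps)
  qed
  have Z: "zeta d \<mu> \<rho> NC \<epsilon> = \<omega> * l ^ NC" using NC by (simp add: zeta_def \<omega>_def l_def)
  have Z0: "0 \<le> \<omega> * l ^ NC" using \<omega> l by simp
  have tri: "norm (lift \<epsilon> \<rho> w0 x0 - lift \<epsilon> \<rho> ws1 xs1) \<le> K * (e + \<sigma>)"
    using norm_triangle_le[OF add_mono[OF z00 z10]] by (simp add: distrib_left)
  show ?thesis
  proof (cases "NP = 0")
    \<comment> \<open>Without prediction steps the predicted optimum never enters. Here
      \<open>zeta\<close> is 1 and \<open>xi\<close> is 0, so \<sigma> has the factor 1 + 2 = 3 in
      \<open>eta0\<close>.\<close>
    case True
    then have "S \<le> K * (e + \<sigma>)" using tri pred0 by (simp add: S_def)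
    from main[OF this] have "norm (w1 - ws1) \<le> \<omega> * l ^ NC * (e + \<sigma>)" .
    also have "\<dots> \<le> \<omega> * l ^ NC * (e + 3 * \<sigma>)" using Z0 \<sigma> by (intro mult_left_mono) auto
    also have "\<dots> = eta1 d \<mu> \<rho> NP NC \<epsilon> * e + eta0 d \<mu> C0 Ts \<rho> NP NC \<epsilon>"
      unfolding eta1_def eta0_def Z by (simp add: True zeta_def xi_def \<sigma>_def mu_bar_def algebra_simps)
    finally show ?thesis by (simp add: e_def)
  next
    case False
    define q where "q = l ^ NP"
    have q: "q \<ge> 0" using l by (simp add: q_def)
    \<comment> \<open>The distance to the predicted optimum shrinks by \<open>q\<close>; the
      distance from there to the next optimum is then added without contraction.\<close>
    define X where "X = q * (e + \<sigma> + \<kappa> * (e + \<sigma>)) + \<kappa> * (e + \<sigma>)"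
    have "norm (lift \<epsilon> \<rho> w0 x0 - lift \<epsilon> \<rho> wsh xsh) \<le> K * (e + \<sigma>) + K * (\<kappa> * (e + \<sigma>))"
      using norm_triangle_le_diff[OF add_mono[OF tri zh1]] by simp
    then have "norm (zh - lift \<epsilon> \<rho> wsh xsh) \<le> q * (K * (e + \<sigma>) + K * (\<kappa> * (e + \<sigma>)))"
      using pred mult_left_mono[OF _ q] unfolding q_def l_def by (meson order_trans)
    from norm_triangle_le[OF add_mono[OF this zh1]]
    have "S \<le> K * X" by (simp add: S_def X_def algebra_simps)
    from main[OF this] have "norm (w1 - ws1) \<le> \<omega> * l ^ NC * X" .
    also have "X \<le> (\<omega> * q + 2 * \<kappa> * (1 + \<omega> * q)) * e + \<sigma> * (\<omega> * q + 2 * (1 + \<kappa> * (1 + \<omega> * q)))"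
    proof -
      have wq: "q \<le> \<omega> * q" using \<omega> q by (simp add: mult_le_cancel_right1)
      have kq: "\<kappa> * q \<le> \<kappa> * (\<omega> * q)" using wq \<kappa>0 by (intro mult_left_mono) auto
      have "0 \<le> \<kappa> * (\<omega> * q)" using \<kappa>0 \<omega> q by simp
      then have "q + \<kappa> * q + \<kappa> \<le> \<omega> * q + 2 * \<kappa> * (1 + \<omega> * q)"
        and "q + \<kappa> * q + \<kappa> \<le> \<omega> * q + 2 * (1 + \<kappa> * (1 + \<omega> * q))"
        using wq kq \<kappa>0 by (simp_all add: distrib_left)
      then have "(q + \<kappa> * q + \<kappa>) * e \<le> (\<omega> * q + 2 * \<kappa> * (1 + \<omega> * q)) * e"
        and "\<sigma> * (q + \<kappa> * q + \<kappa>) \<le> \<sigma> * (\<omega> * q + 2 * (1 + \<kappa> * (1 + \<omega> * q)))"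
        using e \<sigma> by (auto intro: mult_right_mono mult_left_mono)
      moreover have "X = (q + \<kappa> * q + \<kappa>) * e + \<sigma> * (q + \<kappa> * q + \<kappa>)"
        by (simp add: X_def algebra_simps)
      ultimately show ?thesis by linarith
    qed
    finally have "norm (w1 - ws1) \<le> \<omega> * l ^ NC *
        ((\<omega> * q + 2 * \<kappa> * (1 + \<omega> * q)) * e + \<sigma> * (\<omega> * q + 2 * (1 + \<kappa> * (1 + \<omega> * q))))"
      using Z0 by (simp add: mult_left_mono)
    also have "\<dots> = eta1 d \<mu> \<rho> NP NC \<epsilon> * e + eta0 d \<mu> C0 Ts \<rho> NP NC \<epsilon>"
    proof -
      have "zeta d \<mu> \<rho> NP \<epsilon> = \<omega> * q" "xi d \<mu> \<rho> NP \<epsilon> = 1 + \<omega> * q"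
        using False by (simp_all add: zeta_def xi_def \<omega>_def l_def q_def)
      moreover have "C0_bar d \<mu> C0 * Ts / mu_bar \<epsilon> = \<sigma>" by (simp add: \<sigma>_def mu_bar_def)
      ultimately show ?thesis unfolding eta1_def eta0_def Z \<kappa>_def[symmetric]
        by (simp only: distrib_left distrib_right mult.assoc)
    qed
    finally show ?thesis by (simp add: e_def)
  qed
qed

text \<open>Tikhonov: \<open>w\<close> lies in the ball with diameter from \<open>0\<close> to \<open>w'\<close>, whence the bound has
  no factor \<open>2\<close>.\<close>

lemma dual_opt_regularization_error:
  assumes F: "regular F" and o: "dual_opt \<epsilon> F w x" "dual_opt 0 F w' x'" and "\<epsilon> > 0"
  shows "norm (w - w') \<le> norm w'"
proof -
  have P: "P (w - w') = - (w - w')" using o by (simp add: dual_opt_def P_diff)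
  have "(w - w') \<bullet> (\<epsilon> *\<^sub>R w + A x) = 0" "(w - w') \<bullet> A x' = 0"
    using inner_antisym_sym[OF P] o by (auto simp: dual_opt_def)
  moreover have "0 \<le> (w - w') \<bullet> (A x - A x')"
    using o mu_pos by (intro order_trans[OF _ dual_pair_mono[OF F]]) (auto simp: dual_opt_def)
  ultimately have "\<epsilon> * ((w - w') \<bullet> w) \<le> 0" by (simp add: inner_add_right inner_diff_right)
  then have "(w - w') \<bullet> w \<le> 0" using \<open>\<epsilon> > 0\<close> by (simp add: mult_le_0_iff)
  moreover have "(norm (w - w'))\<^sup>2 = (norm w')\<^sup>2 - w \<bullet> w + 2 * ((w - w') \<bullet> w)"
    by (simp add: power2_norm_eq_inner inner_diff_left inner_diff_right inner_commute)
  ultimately have "(norm (w - w'))\<^sup>2 \<le> (norm w')\<^sup>2" using inner_ge_zero[of w] by linarith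
  then show ?thesis by (rule power2_le_imp_le) simp
qed

end

text \<open>The recursion is compared with the fixed point \<open>M\<close> of the map t \<mapsto> q
  t + p. Index 0 is excluded because the initial primal point of the algorithm is arbitrary and not
  derived from a dual vector.\<close>

lemma limsup_affine_recursion:
  fixes e y :: "nat \<Rightarrow> real"
  assumes rec: "\<And>k. k \<ge> 1 \<Longrightarrow> e (Suc k) \<le> q * e k + p" and q: "0 \<le> q" "q < 1" and a: "a \<ge> 0"
    and y: "\<And>k. k \<ge> 1 \<Longrightarrow> y k \<le> a * (e k + C)"
  shows "limsup (\<lambda>k. ereal (y k)) \<le> ereal (a * (p / (1 - q) + C))"
proof -
  define M where "M = p / (1 - q)"
  have M: "p + q * M = M" using q by (simp add: M_def field_simps)
  have b: "e (Suc k) \<le> M + q ^ k * (e 1 - M)" for k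
  proof (induction k)
    case (Suc k)
    have "e (Suc (Suc k)) \<le> q * e (Suc k) + p" using rec by simp
    also have "\<dots> \<le> q * (M + q ^ k * (e 1 - M)) + p" using Suc q by (simp add: mult_left_mono)
    also have "\<dots> = M + q ^ Suc k * (e 1 - M)" using M by (simp add: algebra_simps)
    finally show ?case .
  qed simp
  have "limsup (\<lambda>k. ereal (y k)) = limsup (\<lambda>k. ereal (y (Suc k)))"
    using limsup_shift[of "\<lambda>k. ereal (y k)"] by simp
  also have "\<dots> \<le> limsup (\<lambda>k. ereal (a * (M + q ^ k * (e 1 - M) + C)))"
  proof (intro Limsup_mono always_eventually allI)
    fix k
    have "y (Suc k) \<le> a * (e (Suc k) + C)" using y by simp
    also have "\<dots> \<le> a * (M + q ^ k * (e 1 - M) + C)" using b[of k] a by (intro mult_left_mono) auto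
    finally show "ereal (y (Suc k)) \<le> ereal (a * (M + q ^ k * (e 1 - M) + C))" by simp
  qed
  also have "\<dots> = ereal (a * (M + C))"
  proof (rule lim_imp_Limsup)
    have "(\<lambda>k. a * (M + q ^ k * (e 1 - M) + C)) \<longlonglongrightarrow> a * (M + 0 * (e 1 - M) + C)"
      using q by (intro tendsto_intros) auto
    then show "(\<lambda>k. ereal (a * (M + q ^ k * (e 1 - M) + C))) \<longlonglongrightarrow> ereal (a * (M + C))" by simp
  qed simp
  finally show ?thesis by (simp add: M_def)
qed

section \<open>Gradients of strongly convex functions\<close>

lemma GDERIV_unique:
  assumes "GDERIV g x :> a" "GDERIV g x :> b" shows "a = b"
proof -
  have "(\<lambda>h. h \<bullet> a) = (\<lambda>h. h \<bullet> b)"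
    using assms unfolding gderiv_def by (rule has_derivative_unique)
  then have "(a - b) \<bullet> a = (a - b) \<bullet> b" by meson
  then have "(a - b) \<bullet> (a - b) = 0" by (simp add: inner_diff_right)
  then show ?thesis by simp
qed

lemma grad_eq: "GDERIV g x :> a \<Longrightarrow> grad g x = a"
  unfolding grad_def using GDERIV_unique by blast

lemma DERIV_along_line:
  assumes "GDERIV g (x + s *\<^sub>R v) :> a"
  shows "((\<lambda>s. g (x + s *\<^sub>R v)) has_real_derivative v \<bullet> a) (at s)"
proof -
  have "((\<lambda>s. x + s *\<^sub>R v) has_derivative (\<lambda>h. h *\<^sub>R v)) (at s)"
    by (auto intro!: derivative_eq_intros)
  from has_derivative_compose[OF this, of g "\<lambda>h. h \<bullet> a"] assms
  have "((\<lambda>s. g (x + s *\<^sub>R v)) has_derivative (\<lambda>h. (h *\<^sub>R v) \<bullet> a)) (at s)"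
    by (simp add: gderiv_def)
  then show ?thesis by (simp add: has_field_derivative_def mult_commute_abs)
qed

text \<open>Along the segment, \<open>g\<close> minus its tangent and the quadratic term is
  nondecreasing, by strong monotonicity between \<open>x\<close> and the moving point.\<close>

lemma gradient_lower_bound:
  assumes g: "\<And>y. GDERIV g y :> G y" and G: "strongly_monotone_lipschitz \<mu> L G"
  shows "g x + G x \<bullet> (y - x) + \<mu> / 2 * (norm (y - x))\<^sup>2 \<le> g y"
proof -
  define v where "v = y - x"
  let ?\<phi> = "\<lambda>s. g (x + s *\<^sub>R v) - s * (G x \<bullet> v) - \<mu> / 2 * s\<^sup>2 * (norm v)\<^sup>2"
  have "?\<phi> 0 \<le> ?\<phi> 1"
  proof (rule DERIV_nonneg_imp_nondecreasing[where f = ?\<phi>])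
    fix s :: real assume s: "0 \<le> s" "s \<le> 1"
    have "(?\<phi> has_real_derivative
        (v \<bullet> G (x + s *\<^sub>R v) - G x \<bullet> v - \<mu> * s * (norm v)\<^sup>2)) (at s)"
      by (rule derivative_eq_intros DERIV_along_line g refl)+ (simp add: field_simps)
    moreover have "0 \<le> v \<bullet> G (x + s *\<^sub>R v) - G x \<bullet> v - \<mu> * s * (norm v)\<^sup>2"
    proof (cases "s = 0")
      case True
      then show ?thesis by (simp add: inner_commute)
    next
      case False
      have "\<mu> * (norm ((x + s *\<^sub>R v) - x))\<^sup>2 \<le> (G (x + s *\<^sub>R v) - G x) \<bullet> ((x + s *\<^sub>R v) - x)"
        using G unfolding strongly_monotone_lipschitz_def by blast
      then have "s * (\<mu> * s * (norm v)\<^sup>2) \<le> s * ((G (x + s *\<^sub>R v) - G x) \<bullet> v)"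
        by (simp add: power_mult_distrib power2_eq_square mult_ac)
      then have "\<mu> * s * (norm v)\<^sup>2 \<le> (G (x + s *\<^sub>R v) - G x) \<bullet> v"
        using False s by (simp only: mult_le_cancel_left_pos)
      then show ?thesis by (simp add: inner_diff_left inner_diff_right inner_commute)
    qed
    ultimately show "\<exists>D. (?\<phi> has_real_derivative D) (at s) \<and> 0 \<le> D" by blast
  qed simp
  then show ?thesis by (simp add: v_def)
qed

text \<open>Subtracting the quadratic leaves a convex differentiable \<open>h\<close>. Adding its
  tangent inequalities at \<open>x\<close> and \<open>y\<close> makes its gradient monotone, and
  restoring the quadratic gives the constant \<mu>.\<close>

lemma S_class_gradient:
  assumes "g \<in> S_class \<mu> L"
  shows "GDERIV g x :> grad g x" and "strongly_monotone_lipschitz \<mu> L (grad g)"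
proof -
  have g: "GDERIV g x :> grad g x" for x
    using assms grad_eq[of g x] by (auto simp: S_class_def)
  then show "GDERIV g x :> grad g x" .
  define h where "h = (\<lambda>x. g x - \<mu> / 2 * (norm x)\<^sup>2)"
  have conv: "convex_on UNIV h" using assms by (simp add: S_class_def strongly_convex_def h_def)
  have h: "GDERIV h x :> grad g x - \<mu> *\<^sub>R x" for x
  proof -
    have "((\<lambda>x. \<mu> / 2 * (x \<bullet> x)) has_derivative (\<lambda>y. y \<bullet> (\<mu> *\<^sub>R x))) (at x)"
      by (auto intro!: derivative_eq_intros simp: inner_commute)
    then have "GDERIV (\<lambda>x. \<mu> / 2 * (norm x)\<^sup>2) x :> \<mu> *\<^sub>R x"
      by (simp add: gderiv_def power2_norm_eq_inner)
    then show ?thesis unfolding h_def by (intro GDERIV_diff g)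
  qed
  have tangent: "(y - x) \<bullet> (grad g x - \<mu> *\<^sub>R x) \<le> h y - h x" for x y
  proof -
    let ?p = "\<lambda>s. h (x + s *\<^sub>R (y - x))"
    have "convex_on UNIV ?p"
    proof (rule convex_onI)
      fix t a b :: real assume t: "0 < t" "t < 1"
      have "x + ((1 - t) *\<^sub>R a + t *\<^sub>R b) *\<^sub>R (y - x)
          = (1 - t) *\<^sub>R (x + a *\<^sub>R (y - x)) + t *\<^sub>R (x + b *\<^sub>R (y - x))"
        by (simp add: algebra_simps)
      then show "?p ((1 - t) *\<^sub>R a + t *\<^sub>R b) \<le> (1 - t) * ?p a + t * ?p b"
        using convex_onD[OF conv, of t "x + a *\<^sub>R (y - x)" "x + b *\<^sub>R (y - x)"] t by simp
    qed simp
    moreover have "(?p has_real_derivative (y - x) \<bullet> (grad g x - \<mu> *\<^sub>R x)) (at 0)"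
      by (rule DERIV_along_line) (use h[of x] in simp)
    ultimately have "(y - x) \<bullet> (grad g x - \<mu> *\<^sub>R x) * (1 - 0) \<le> ?p 1 - ?p 0"
      by (intro convex_on_imp_above_tangent[where A = UNIV]) auto
    then show ?thesis by simp
  qed
  have "\<mu> * (norm (x - y))\<^sup>2 \<le> (grad g x - grad g y) \<bullet> (x - y)" for x y
  proof -
    have "0 \<le> ((grad g x - \<mu> *\<^sub>R x) - (grad g y - \<mu> *\<^sub>R y)) \<bullet> (x - y)"
    proof -
      have "(p - q) \<bullet> (x - y) = - ((y - x) \<bullet> p) - (x - y) \<bullet> q" for p q
        by (simp add: inner_diff_left inner_diff_right inner_commute)
      then show ?thesis using tangent[of x y] tangent[of y x] by simp
    qed
    also have "(grad g x - \<mu> *\<^sub>R x) - (grad g y - \<mu> *\<^sub>R y) = (grad g x - grad g y) - \<mu> *\<^sub>R (x - y)"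
      by (simp add: scaleR_diff_right)
    finally show ?thesis by (simp add: inner_diff_left power2_norm_eq_inner)
  qed
  moreover have "norm (grad g x - grad g y) \<le> L * norm (x - y)" for x y
    using assms by (auto simp: S_class_def dest!: lipschitz_onD[of L UNIV "grad g" x y] simp: dist_norm)
  ultimately show "strongly_monotone_lipschitz \<mu> L (grad g)"
    by (simp add: strongly_monotone_lipschitz_def)
qed

text \<open>\<open>arg_min\<close> is a choice operator, so a minimizer has to be exhibited first:
  the zero of \<open>G\<close>. Quadratic growth around it then identifies the chosen point.\<close>

lemma gradient_arg_min:
  fixes g :: "'a::{real_inner,complete_space} \<Rightarrow> real"
  assumes g: "\<And>y. GDERIV g y :> G y" and G: "strongly_monotone_lipschitz \<mu> L G"
    and pos: "\<mu> > 0" "L > 0"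
  shows "G (arg_min g (\<lambda>_. True)) = 0"
proof -
  obtain x where x: "G x = 0" using strongly_monotone_lipschitz_surj[OF G pos] by blast
  have lb: "g x + \<mu> / 2 * (norm (y - x))\<^sup>2 \<le> g y" for y
    using gradient_lower_bound[OF g G, of x y] x by simp
  have "g x \<le> g y" for y
  proof -
    have "0 \<le> \<mu> / 2 * (norm (y - x))\<^sup>2" using pos by simp
    then show ?thesis using lb[of y] by linarith
  qed
  then have "is_arg_min g (\<lambda>_. True) x" by (auto simp: is_arg_min_def not_less)
  then have "is_arg_min g (\<lambda>_. True) (arg_min g (\<lambda>_. True))" unfolding arg_min_def by (rule someI)
  then have "g (arg_min g (\<lambda>_. True)) \<le> g x" by (auto simp: is_arg_min_def not_less)
  with lb[of "arg_min g (\<lambda>_. True)"] have "\<mu> / 2 * (norm (arg_min g (\<lambda>_. True) - x))\<^sup>2 \<le> 0" by simp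
  then have "arg_min g (\<lambda>_. True) = x" using pos by (simp add: mult_le_0_iff)
  then show ?thesis using x by simp
qed

lemma DERIV_lower_bound:
  fixes \<phi> :: "real \<Rightarrow> real"
  assumes "(\<phi> has_real_derivative D) (at 0)" and "\<And>s. s > 0 \<Longrightarrow> m * s \<le> \<phi> s - \<phi> 0"
  shows "m \<le> D"
proof -
  have "((\<lambda>s. (\<phi> s - \<phi> 0) / (s - 0)) \<longlongrightarrow> D) (at_right 0)"
    using assms(1) has_field_derivative_iff tendsto_within_subset[of _ _ 0 UNIV] by blast
  moreover have "\<forall>\<^sub>F s in at_right 0. m \<le> (\<phi> s - \<phi> 0) / (s - 0)"
    using assms(2) by (auto simp: eventually_at_filter field_simps intro!: always_eventually)
  ultimately show ?thesis by (intro tendsto_lowerbound) auto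
qed

text \<open>The Hessian inherits both constants as a limit of difference quotients along lines.
  Hence predicted gradients are as regular as the true ones.\<close>

lemma frechet_derivative_strongly_monotone_lipschitz:
  fixes G :: "'a::real_inner \<Rightarrow> 'a"
  assumes G: "strongly_monotone_lipschitz \<mu> L G" and diff: "G differentiable (at x)"
  shows "strongly_monotone_lipschitz \<mu> L (\<lambda>y. a + frechet_derivative G (at x) (y - x) + b)"
proof -
  define H where "H = frechet_derivative G (at x)"
  have H: "(G has_derivative H) (at x)" using diff by (simp add: H_def frechet_derivative_works)
  then have lin: "linear H" by (rule has_derivative_linear)
  have line: "((\<lambda>s. G (x + s *\<^sub>R v) \<bullet> u) has_real_derivative H v \<bullet> u) (at 0)" for u v
  proof -
    have "((\<lambda>s. x + s *\<^sub>R v) has_derivative (\<lambda>h. h *\<^sub>R v)) (at 0)"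
      by (auto intro!: derivative_eq_intros)
    from has_derivative_compose[OF this, of G H] H
    have "((\<lambda>s. G (x + s *\<^sub>R v)) has_derivative (\<lambda>h. H (h *\<^sub>R v))) (at 0)" by simp
    from has_derivative_inner_left[OF this, of u] show ?thesis
      by (simp add: has_field_derivative_def linear_scale[OF lin] mult_commute_abs)
  qed
  have mono: "\<mu> * (norm v)\<^sup>2 \<le> H v \<bullet> v" for v
  proof (rule DERIV_lower_bound[OF line])
    fix s :: real assume s: "s > 0"
    have "\<mu> * (norm ((x + s *\<^sub>R v) - x))\<^sup>2 \<le> (G (x + s *\<^sub>R v) - G x) \<bullet> ((x + s *\<^sub>R v) - x)"
      using G unfolding strongly_monotone_lipschitz_def by blast
    then have "s * (\<mu> * (norm v)\<^sup>2 * s) \<le> s * ((G (x + s *\<^sub>R v) - G x) \<bullet> v)"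
      by (simp add: power_mult_distrib power2_eq_square mult_ac)
    then have "\<mu> * (norm v)\<^sup>2 * s \<le> (G (x + s *\<^sub>R v) - G x) \<bullet> v"
      using s by (simp only: mult_le_cancel_left_pos)
    then show "\<mu> * (norm v)\<^sup>2 * s \<le> G (x + s *\<^sub>R v) \<bullet> v - G (x + 0 *\<^sub>R v) \<bullet> v"
      by (simp add: inner_diff_left)
  qed
  \<comment> \<open>Testing against H v itself yields |H v|^2 \<le> L |v| |H v|. The minus signs
    convert this upper bound into the lower bound that \<open>DERIV_lower_bound\<close>
    provides.\<close>
  have lip: "norm (H v) \<le> L * norm v" for v
  proof -
    have "- (L * norm v * norm (H v)) \<le> - (H v \<bullet> H v)"
    proof (rule DERIV_lower_bound[OF DERIV_minus[OF line]])
      fix s :: real assume s: "s > 0"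
      have "(G (x + s *\<^sub>R v) - G x) \<bullet> H v \<le> norm (G (x + s *\<^sub>R v) - G x) * norm (H v)"
        by (rule norm_cauchy_schwarz)
      also have "\<dots> \<le> L * norm ((x + s *\<^sub>R v) - x) * norm (H v)"
        using G unfolding strongly_monotone_lipschitz_def by (blast intro: mult_right_mono norm_ge_zero)
      finally show "- (L * norm v * norm (H v)) * s \<le> - (G (x + s *\<^sub>R v) \<bullet> H v) - - (G (x + 0 *\<^sub>R v) \<bullet> H v)"
        using s by (simp add: inner_diff_left mult_ac)
    qed
    then have "norm (H v) * norm (H v) \<le> L * norm v * norm (H v)"
      by (simp add: power2_norm_eq_inner[symmetric] power2_eq_square)
    moreover have "0 \<le> L * norm v"
    proof -
      have "norm (G v - G 0) \<le> L * norm (v - 0)"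
        using G unfolding strongly_monotone_lipschitz_def by blast
      from order_trans[OF norm_ge_zero this] show ?thesis by simp
    qed
    ultimately show ?thesis by (cases "H v = 0") (auto simp: mult_le_cancel_right)
  qed
  have "(a + H (y - x) + b) - (a + H (z - x) + b) = H (y - z)" for y z
    by (simp add: linear_diff[OF lin])
  then show ?thesis
    using mono lip by (simp add: strongly_monotone_lipschitz_def H_def)
qed

lemma gradient_time_drift:
  fixes G :: "real \<Rightarrow> 'a::real_normed_vector"
  assumes "\<And>s. s \<ge> 0 \<Longrightarrow> G differentiable (at s within {0..})"
    and "\<And>s. s \<ge> 0 \<Longrightarrow> norm (vector_derivative G (at s within {0..})) \<le> C"
    and "0 \<le> a" "a \<le> b"
  shows "norm (G a - G b) \<le> C * (b - a)"
proof -
  have "norm (G a - G b) \<le> C * norm (a - b)"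
  proof (rule differentiable_bound[of "{0..}" G "\<lambda>s h. h *\<^sub>R vector_derivative G (at s within {0..})"])
    fix s :: real assume "s \<in> {0..}"
    then show "(G has_derivative (\<lambda>h. h *\<^sub>R vector_derivative G (at s within {0..}))) (at s within {0..})"
      using assms(1) by (simp add: vector_derivative_works has_vector_derivative_def)
    show "onorm (\<lambda>h. h *\<^sub>R vector_derivative G (at s within {0..})) \<le> C"
    proof (rule onorm_le)
      fix h :: real
      show "norm (h *\<^sub>R vector_derivative G (at s within {0..})) \<le> C * norm h"
        using mult_left_mono[OF assms(2)[of s] abs_ge_zero[of h]] \<open>s \<in> {0..}\<close> by (simp add: mult.commute)
    qed
  qed (use assms in auto)
  then show ?thesis using assms by (simp add: abs_minus_commute[of a])
qed

section \<open>Stacking the local gradients\<close>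

definition stack :: "('v \<Rightarrow> 'a \<Rightarrow> 'b) \<Rightarrow> 'a^'v \<Rightarrow> 'b^'v" where
  "stack G x = (\<chi> i. G i (x $ i))"

lemma norm_sq_vec: "(norm (x :: 'a::real_inner^'v::finite))\<^sup>2 = (\<Sum>i\<in>UNIV. (norm (x $ i))\<^sup>2)"
  by (simp add: power2_norm_eq_inner inner_vec_def)

lemma stack_strongly_monotone_lipschitz:
  fixes G :: "'v::finite \<Rightarrow> 'a::real_inner \<Rightarrow> 'a"
  assumes G: "\<And>i. strongly_monotone_lipschitz \<mu> L (G i)" and "L > 0"
  shows "strongly_monotone_lipschitz \<mu> L (stack G)"
  unfolding strongly_monotone_lipschitz_def
proof (intro conjI allI)
  fix x y :: "'a^'v"
  show "\<mu> * (norm (x - y))\<^sup>2 \<le> (stack G x - stack G y) \<bullet> (x - y)"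
    using G unfolding norm_sq_vec sum_distrib_left inner_vec_def
    by (intro sum_mono) (simp add: stack_def strongly_monotone_lipschitz_def)
  have "(norm (stack G x - stack G y))\<^sup>2 \<le> (L * norm (x - y))\<^sup>2"
    unfolding power_mult_distrib norm_sq_vec sum_distrib_left
    unfolding power_mult_distrib[symmetric]
    using G by (intro sum_mono power_mono) (simp_all add: stack_def strongly_monotone_lipschitz_def)
  then show "norm (stack G x - stack G y) \<le> L * norm (x - y)"
    by (rule power2_le_imp_le) (use \<open>L > 0\<close> in simp)
qed

text \<open>The square root of the number of nodes enters here: the drift bounds are uniform over
  the nodes, while the stacked norm is Euclidean.\<close>

lemma norm_vec_le_uniform:
  fixes x :: "'a::real_inner^'v::finite"
  assumes "\<And>i. norm (x $ i) \<le> b" and "b \<ge> 0"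
  shows "norm x \<le> sqrt (real CARD('v)) * b"
proof -
  have "(norm x)\<^sup>2 \<le> (\<Sum>i\<in>(UNIV::'v set). b\<^sup>2)"
    unfolding norm_sq_vec using assms by (intro sum_mono power_mono) auto
  also have "\<dots> = (sqrt (real CARD('v)) * b)\<^sup>2" by (simp add: power_mult_distrib)
  finally show ?thesis by (rule power2_le_imp_le) (use assms in simp)
qed

section \<open>Consensus over a graph\<close>

lemma sum_UNIV_prod: "(\<Sum>e\<in>UNIV. h (e :: 'v::finite \<times> 'w::finite)) = (\<Sum>i\<in>UNIV. \<Sum>j\<in>UNIV. h (i, j))"
  unfolding sum.cartesian_product by simp

lemma linear_A_op: "linear (A_op E)"
  by (rule linearI) (auto simp: A_op_def vec_eq_iff)

lemma linear_P_op: "linear P_op"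
  by (rule linearI) (auto simp: P_op_def vec_eq_iff)

lemma P_op_P_op: "P_op (P_op w) = w"
  by (simp add: P_op_def vec_eq_iff)

lemma P_op_inner: "P_op u \<bullet> v = u \<bullet> P_op v"
  unfolding inner_vec_def
  by (rule sum.reindex_bij_witness[of _ prod.swap prod.swap]) (auto simp: P_op_def prod.swap_def)

lemma adjoint_A_op:
  fixes E :: "('v::finite \<times> 'v) set" and w :: "real^'n^('v \<times> 'v)"
  shows "adjoint (A_op E) w $ i = (\<Sum>j\<in>E `` {i}. w $ (i, j))"
proof -
  have "adjoint (A_op E) = (\<lambda>w :: real^'n^('v \<times> 'v). \<chi> i. \<Sum>j\<in>E `` {i}. w $ (i, j))"
  proof (rule adjoint_unique, intro allI)
    fix x :: "real^'n^'v" and w :: "real^'n^('v \<times> 'v)"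
    have "A_op E x \<bullet> w = (\<Sum>i\<in>UNIV. \<Sum>j\<in>UNIV. if (i, j) \<in> E then x $ i \<bullet> w $ (i, j) else 0)"
      unfolding inner_vec_def sum_UNIV_prod by (intro sum.cong refl) (simp add: A_op_def inner_vec_def)
    also have "\<dots> = (\<Sum>i\<in>UNIV. \<Sum>j\<in>E `` {i}. x $ i \<bullet> w $ (i, j))"
      by (rule sum.cong[OF refl]) (simp add: sum.If_cases Image_singleton)
    also have "\<dots> = x \<bullet> (\<chi> i. \<Sum>j\<in>E `` {i}. w $ (i, j))"
      by (simp add: inner_vec_def[of x] inner_sum_right)
    finally show "A_op E x \<bullet> w = x \<bullet> (\<chi> i. \<Sum>j\<in>E `` {i}. w $ (i, j))" .
  qed
  then show ?thesis by simp
qed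

lemma norm_sq_A_op: "(norm (A_op E x))\<^sup>2 = (\<Sum>i\<in>UNIV. real (card (E `` {i})) * (norm (x $ i))\<^sup>2)"
proof -
  have "(norm (A_op E x))\<^sup>2 = (\<Sum>i\<in>UNIV. \<Sum>j\<in>UNIV. if (i, j) \<in> E then (norm (x $ i))\<^sup>2 else 0)"
    unfolding norm_sq_vec[of "A_op E x"] sum_UNIV_prod by (intro sum.cong refl) (simp add: A_op_def)
  also have "\<dots> = (\<Sum>i\<in>UNIV. real (card (E `` {i})) * (norm (x $ i))\<^sup>2)"
    by (intro sum.cong refl) (simp add: sum.If_cases Image_def)
  finally show ?thesis .
qed

lemma norm_A_op: "norm (A_op E x) \<le> sqrt (real (max_degree E)) * norm x"
proof -
  have "(norm (A_op E x))\<^sup>2 \<le> (\<Sum>i\<in>UNIV. real (max_degree E) * (norm (x $ i))\<^sup>2)"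
    unfolding max_degree_def norm_sq_A_op by (intro sum_mono mult_right_mono) auto
  also have "\<dots> = (sqrt (real (max_degree E)) * norm x)\<^sup>2"
    by (simp add: power_mult_distrib norm_sq_vec[of x] sum_distrib_left)
  finally show ?thesis by (rule power2_le_imp_le) simp
qed

text \<open>In the theorem below, the type of \<open>A_op E\<close> inside \<open>onorm\<close> has a block dimension of its own,
  not tied to \<open>'n\<close>.\<close>

lemma onorm_A_op:
  fixes E :: "('v::finite \<times> 'v) set"
  shows "onorm (A_op E :: real^'n^'v \<Rightarrow> real^'n^('v \<times> 'v)) = sqrt (real (max_degree E))"
proof (rule antisym)
  let ?A = "A_op E :: real^'n^'v \<Rightarrow> real^'n^('v \<times> 'v)"
  show "onorm ?A \<le> sqrt (real (max_degree E))" by (rule onorm_le) (rule norm_A_op)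
  have "max_degree E \<in> range (\<lambda>i. card (E `` {i}))" unfolding max_degree_def by (rule Max_in) auto
  then obtain i where i: "max_degree E = card (E `` {i})" by auto
  \<comment> \<open>The norm is attained at a unit vector supported in one block of maximal degree;
    any coordinate inside the block will do.\<close>
  define x :: "real^'n^'v" where "x = axis i (axis undefined 1)"
  have x: "(norm (x $ k))\<^sup>2 = (if k = i then 1 else 0)" for k by (simp add: x_def axis_def[of i])
  have "(norm x)\<^sup>2 = 1" using norm_sq_vec[of x] by (simp add: x)
  then have "norm x = 1" using norm_ge_zero[of x] by (simp add: power2_eq_1_iff)
  moreover have "(norm (?A x))\<^sup>2 = real (max_degree E)" by (simp add: norm_sq_A_op x i if_distrib cong: if_cong)
  then have "norm (?A x) = sqrt (real (max_degree E))" by (metis norm_ge_zero real_sqrt_unique)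
  moreover have "bounded_linear ?A" using linear_A_op linear_conv_bounded_linear by blast
  ultimately show "sqrt (real (max_degree E)) \<le> onorm ?A" using onorm[of ?A x] by simp
qed

lemma consensus_dual_A_op:
  assumes "\<mu> > 0" "L > 0" "max_degree E > 0"
  shows "consensus_dual (A_op E) P_op \<mu> L (real (max_degree E))"
  unfolding consensus_dual_def
  using assms linear_A_op linear_P_op P_op_P_op P_op_inner norm_A_op by auto

text \<open>The penalty keeps the constant \<mu> and raises the Lipschitz constant to L + k, so
  \<open>gradient_arg_min\<close> applies to the local subproblem.\<close>

lemma local_min_stationary:
  fixes E :: "('v::finite \<times> 'v) set" and g :: "'v \<Rightarrow> real^'n \<Rightarrow> real" and z :: "real^'n^('v \<times> 'v)"
  assumes g: "\<And>y. GDERIV (g i) y :> G y" and G: "strongly_monotone_lipschitz \<mu> L G"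
    and pos: "\<mu> > 0" "L > 0" "\<epsilon> > 0" "\<rho> > 0"
  defines "\<delta> \<equiv> 1 / (1 + \<epsilon> * \<rho>)" and "x \<equiv> local_min E \<epsilon> \<rho> g z i"
  shows "G x + (\<rho> * \<delta> * real (card (E `` {i}))) *\<^sub>R x = \<delta> *\<^sub>R (\<Sum>j\<in>E `` {i}. z $ (i, j))"
proof -
  define k where "k = \<rho> * \<delta> * real (card (E `` {i}))"
  define s where "s = (\<Sum>j\<in>E `` {i}. z $ (i, j))"
  let ?h = "\<lambda>y. g i y + k / 2 * (norm y)\<^sup>2 - \<delta> * (y \<bullet> s)"
  let ?H = "\<lambda>y. G y + k *\<^sub>R y - \<delta> *\<^sub>R s"
  have k: "k \<ge> 0" using pos by (simp add: k_def \<delta>_def)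
  have "GDERIV ?h y :> ?H y" for y
  proof (intro GDERIV_diff GDERIV_add g)
    have "((\<lambda>x. k / 2 * (x \<bullet> x)) has_derivative (\<lambda>h. h \<bullet> (k *\<^sub>R y))) (at y)"
      by (auto intro!: derivative_eq_intros simp: inner_commute)
    then show "GDERIV (\<lambda>y. k / 2 * (norm y)\<^sup>2) y :> k *\<^sub>R y"
      by (simp add: gderiv_def power2_norm_eq_inner)
    show "GDERIV (\<lambda>y. \<delta> * (y \<bullet> s)) y :> \<delta> *\<^sub>R s"
      unfolding gderiv_def by (auto intro!: derivative_eq_intros)
  qed
  moreover have "strongly_monotone_lipschitz \<mu> (L + k) ?H"
    unfolding strongly_monotone_lipschitz_def
  proof (intro conjI allI)
    fix u v
    have eq: "?H u - ?H v = (G u - G v) + k *\<^sub>R (u - v)" by (simp add: scaleR_diff_right)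
    have "0 \<le> k * (norm (u - v))\<^sup>2" using k by simp
    moreover have "\<mu> * (norm (u - v))\<^sup>2 \<le> (G u - G v) \<bullet> (u - v)"
      using G unfolding strongly_monotone_lipschitz_def by blast
    ultimately show "\<mu> * (norm (u - v))\<^sup>2 \<le> (?H u - ?H v) \<bullet> (u - v)"
      unfolding eq inner_add_left by (simp add: power2_norm_eq_inner)
    have "norm ((G u - G v) + k *\<^sub>R (u - v)) \<le> norm (G u - G v) + norm (k *\<^sub>R (u - v))"
      by (rule norm_triangle_ineq)
    moreover have "norm (G u - G v) \<le> L * norm (u - v)"
      using G unfolding strongly_monotone_lipschitz_def by blast
    ultimately show "norm (?H u - ?H v) \<le> (L + k) * norm (u - v)"
      unfolding eq using k by (simp add: distrib_right)
  qed
  ultimately have "?H (arg_min ?h (\<lambda>_. True)) = 0"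
    by (rule gradient_arg_min) (use pos k in simp_all)
  moreover have "arg_min ?h (\<lambda>_. True) = x"
    by (simp add: x_def local_min_def Let_def k_def s_def \<delta>_def)
  ultimately show ?thesis by (simp add: k_def s_def)
qed

section \<open>The ADMM step as a reflected resolvent\<close>

lemma zero_edge_space: "0 \<in> edge_space E"
  by (simp add: edge_space_def)

lemma admm_step_edge_space: "admm_step E \<epsilon> \<rho> g z \<in> edge_space E"
  by (simp add: edge_space_def admm_step_def Let_def)

lemma funpow_admm_step_edge_space:
  "z \<in> edge_space E \<Longrightarrow> (admm_step E \<epsilon> \<rho> g ^^ n) z \<in> edge_space E"
  by (induction n) (auto simp: admm_step_edge_space)

text \<open>The witness is w = \<delta> (z - \<rho> A x). Since A^T A is the diagonal of degrees,
  the local stationarity conditions stack to F x = A^T w for the stacked gradient F. Since \<delta>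
  (1 + \<epsilon> \<rho>) = 1, \<open>z\<close> is the lift of \<open>w\<close>, and the update is z
  - 2 w = (1 - 2 \<delta>) z + 2 \<delta> \<rho> A x with its blocks swapped by P.\<close>

lemma admm_step_resolvent:
  fixes E :: "('v::finite \<times> 'v) set" and g :: "'v \<Rightarrow> real^'n \<Rightarrow> real" and z :: "real^'n^('v \<times> 'v)"
  assumes g: "\<And>i y. GDERIV (g i) y :> G i y" and G: "\<And>i. strongly_monotone_lipschitz \<mu> L (G i)"
    and pos: "\<mu> > 0" "L > 0" "\<epsilon> > 0" "\<rho> > 0" and "sym E" and z: "z \<in> edge_space E"
  defines "x \<equiv> \<chi> i. local_min E \<epsilon> \<rho> g z i"
  obtains w where "stack G x = adjoint (A_op E) w" "w + \<rho> *\<^sub>R (\<epsilon> *\<^sub>R w + A_op E x) = z"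
    "admm_step E \<epsilon> \<rho> g z = - P_op (2 *\<^sub>R w - z)"
proof
  define \<delta> where "\<delta> = 1 / (1 + \<epsilon> * \<rho>)"
  have den: "1 + \<epsilon> * \<rho> > 0" using pos by (simp add: add_pos_pos)
  let ?w = "\<delta> *\<^sub>R (z - \<rho> *\<^sub>R A_op E x)"
  show "stack G x = adjoint (A_op E) ?w"
  proof (rule iffD2[OF vec_eq_iff], rule allI)
    fix i
    have "G i (x $ i) + (\<rho> * \<delta> * real (card (E `` {i}))) *\<^sub>R x $ i = \<delta> *\<^sub>R (\<Sum>j\<in>E `` {i}. z $ (i, j))"
      using local_min_stationary[OF g G pos] by (simp add: x_def \<delta>_def)
    moreover have "adjoint (A_op E) ?w $ i
        = \<delta> *\<^sub>R (\<Sum>j\<in>E `` {i}. z $ (i, j)) - (\<rho> * \<delta> * real (card (E `` {i}))) *\<^sub>R x $ i"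
    proof -
      have "adjoint (A_op E) ?w $ i = (\<Sum>j\<in>E `` {i}. \<delta> *\<^sub>R (z $ (i, j) - \<rho> *\<^sub>R x $ i))"
        unfolding adjoint_A_op by (intro sum.cong refl) (auto simp: A_op_def)
      also have "\<dots> = \<delta> *\<^sub>R (\<Sum>j\<in>E `` {i}. z $ (i, j)) - (\<rho> * \<delta> * real (card (E `` {i}))) *\<^sub>R x $ i"
        by (simp add: scaleR_sum_right[symmetric] sum_subtractf sum_constant_scaleR scaleR_diff_right mult_ac
            del: sum_constant)
      finally show ?thesis .
    qed
    ultimately show "stack G x $ i = adjoint (A_op E) ?w $ i"
      by (simp add: stack_def eq_diff_eq[symmetric])
  qed
  have "?w + \<rho> *\<^sub>R (\<epsilon> *\<^sub>R ?w + A_op E x) = (1 + \<epsilon> * \<rho>) *\<^sub>R ?w + \<rho> *\<^sub>R A_op E x"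
    by (simp add: algebra_simps)
  also have "(1 + \<epsilon> * \<rho>) *\<^sub>R ?w = z - \<rho> *\<^sub>R A_op E x"
    using den by (simp add: \<delta>_def)
  finally show "?w + \<rho> *\<^sub>R (\<epsilon> *\<^sub>R ?w + A_op E x) = z" by simp
  \<comment> \<open>Off the graph both sides vanish, by symmetry of \<open>E\<close> and because
    \<open>z\<close> lies in the edge space.\<close>
  have "admm_step E \<epsilon> \<rho> g z $ e = (- P_op (2 *\<^sub>R ?w - z)) $ e" for e
  proof (cases "e \<in> E")
    case True
    then have "(snd e, fst e) \<in> E" using \<open>sym E\<close> by (metis prod.collapse symD)
    then show ?thesis using True
      by (simp add: admm_step_def P_op_def A_op_def x_def Let_def \<delta>_def[symmetric] algebra_simps scaleR_2)
  next
    case False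
    then have "(snd e, fst e) \<notin> E" using \<open>sym E\<close> by (metis prod.collapse symD)
    then show ?thesis using False z
      by (simp add: admm_step_def P_op_def A_op_def edge_space_def Let_def)
  qed
  then show "admm_step E \<epsilon> \<rho> g z = - P_op (2 *\<^sub>R ?w - z)"
    by (rule iffD2[OF vec_eq_iff, OF allI])
qed

section \<open>Conjugates, primal solutions and dual solutions\<close>

lemma convex_conj_gradient:
  assumes "\<And>y. \<Phi> x + p \<bullet> (y - x) \<le> \<Phi> y"
  shows "convex_conj UNIV (\<lambda>x. ereal (\<Phi> x)) p = ereal (p \<bullet> x - \<Phi> x)"
  unfolding convex_conj_def
proof (rule antisym)
  show "(SUP y. ereal (p \<bullet> y) - ereal (\<Phi> y)) \<le> ereal (p \<bullet> x - \<Phi> x)"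
  proof (rule SUP_least)
    fix y show "ereal (p \<bullet> y) - ereal (\<Phi> y) \<le> ereal (p \<bullet> x - \<Phi> x)"
      using assms[of y] by (simp add: inner_diff_right)
  qed
  show "ereal (p \<bullet> x - \<Phi> x) \<le> (SUP y. ereal (p \<bullet> y) - ereal (\<Phi> y))"
    by (rule SUP_upper2[of x]) auto
qed

lemma P_op_edge_space: "sym E \<Longrightarrow> w \<in> edge_space E \<Longrightarrow> P_op w \<in> edge_space E"
  by (auto simp: edge_space_def P_op_def dest: symD)

text \<open>The conjugate of the indicator of a subspace is the indicator of its orthogonal
  complement; inside the edge space the symmetric vectors have the antisymmetric ones as
  complement.\<close>

lemma convex_conj_indicator_ker:
  fixes w :: "real^'n^('v::finite \<times> 'v)"
  assumes "sym E" and w: "w \<in> edge_space E"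
  shows "convex_conj (edge_space E) (ext_indicator (ker_I_P E)) (- w) = (if P_op w = - w then 0 else \<infinity>)"
proof (cases "P_op w = - w")
  case True
  have "convex_conj (edge_space E) (ext_indicator (ker_I_P E)) (- w) = 0"
    unfolding convex_conj_def
  proof (rule antisym)
    show "(SUP y\<in>edge_space E. ereal (- w \<bullet> y) - ext_indicator (ker_I_P E) y) \<le> 0"
    proof (rule SUP_least)
      fix y :: "real^'n^('v \<times> 'v)"
      have "w \<bullet> y = 0" if "y - P_op y = 0" using P_op_inner[of w y] True that by simp
      then show "ereal (- w \<bullet> y) - ext_indicator (ker_I_P E) y \<le> 0"
        by (auto simp: ext_indicator_def ker_I_P_def)
    qed
    show "0 \<le> (SUP y\<in>edge_space E. ereal (- w \<bullet> y) - ext_indicator (ker_I_P E) y)"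
      using linear_0[OF linear_P_op]
      by (intro SUP_upper2[of 0]) (auto simp: ext_indicator_def ker_I_P_def zero_edge_space)
  qed
  then show ?thesis using True by simp
next
  case False
  \<comment> \<open>This is twice the symmetric part of \<open>w\<close>. It satisfies 2 (w . u) = u
    . u > 0, so its negative multiples drive the supremum to infinity.\<close>
  define u where "u = w + P_op w"
  have Pu: "P_op u = u" by (simp add: u_def linear_add[OF linear_P_op] P_op_P_op add.commute)
  have u: "u \<in> edge_space E" using w P_op_edge_space[OF assms] by (simp add: u_def edge_space_def)
  have "u \<noteq> 0" using False by (simp add: u_def eq_neg_iff_add_eq_0 add.commute)
  then have uu: "u \<bullet> u > 0" by simp
  have "w \<bullet> u = P_op w \<bullet> u" using P_op_inner[of w u] Pu by simp
  then have wu: "2 * (w \<bullet> u) = u \<bullet> u" by (subst (2) u_def) (simp add: inner_add_left)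
  have "convex_conj (edge_space E) (ext_indicator (ker_I_P E)) (- w) = \<infinity>"
    unfolding convex_conj_def
  proof (rule SUP_PInfty)
    fix n :: nat
    define s where "s = - (2 * real n / (u \<bullet> u))"
    have "s *\<^sub>R u \<in> edge_space E" using u by (simp add: edge_space_def)
    moreover have "s *\<^sub>R u \<in> ker_I_P E"
      using calculation Pu by (simp add: ker_I_P_def linear_scale[OF linear_P_op])
    moreover have "- w \<bullet> (s *\<^sub>R u) = real n" using wu uu by (simp add: s_def field_simps)
    ultimately show "\<exists>y\<in>edge_space E. ereal (real n) \<le> ereal (- w \<bullet> y) - ext_indicator (ker_I_P E) y"
      by (intro bexI[of _ "s *\<^sub>R u"]) (auto simp: ext_indicator_def)
  qed
  then show ?thesis using False by simp
qed

abbreviation stacked_grad ::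
  "('v \<Rightarrow> real^'n \<Rightarrow> real \<Rightarrow> real) \<Rightarrow> real \<Rightarrow> real^'n^'v::finite \<Rightarrow> real^'n^'v" where
  "stacked_grad f t \<equiv> stack (\<lambda>i. grad (\<lambda>u. f i u t))"

lemma total_cost_lower_bound:
  fixes x y :: "real^'n^'v::finite"
  assumes "\<And>i. (\<lambda>u. f i u t) \<in> S_class \<mu> L"
  shows "total_cost f t x + stacked_grad f t x \<bullet> (y - x) + \<mu> / 2 * (norm (y - x))\<^sup>2 \<le> total_cost f t y"
  unfolding total_cost_def inner_vec_def[of "stacked_grad f t x"] norm_sq_vec[of "y - x"]
    sum_distrib_left sum.distrib[symmetric]
proof (rule sum_mono)
  fix i
  show "f i (x $ i) t + stacked_grad f t x $ i \<bullet> (y - x) $ i + \<mu> / 2 * (norm ((y - x) $ i))\<^sup>2 \<le> f i (y $ i) t"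
    using gradient_lower_bound[OF S_class_gradient[OF assms], of i "x $ i" "y $ i"]
    by (simp add: stack_def)
qed

text \<open>The gradient at \<open>x'\<close> is A^T w, and the antisymmetric \<open>w\<close> is
  orthogonal to the symmetric A (x - x'). The first-order term vanishes, and the quadratic term of
  strong convexity forces equality.\<close>

lemma primal_solution_eq:
  fixes x x' :: "real^'n^'v::finite"
  assumes f: "\<And>i. (\<lambda>u. f i u t) \<in> S_class \<mu> L" and "\<mu> > 0"
    and sol: "is_primal_solution E f t x y"
    and opt: "stacked_grad f t x' = adjoint (A_op E) w" "P_op w = - w" "P_op (A_op E x') = A_op E x'"
  shows "x = x'"
proof -
  have edge: "A_op E u \<in> edge_space E" for u by (simp add: edge_space_def A_op_def)
  have "A_op E x' \<in> ker_I_P E" using opt(3) edge by (simp add: ker_I_P_def)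
  then have "ext_indicator (ker_I_P E) (A_op E x') = 0" by (simp add: ext_indicator_def)
  moreover have y: "y = A_op E x" and "\<not> ereal (total_cost f t x') + ext_indicator (ker_I_P E) (A_op E x')
      < ereal (total_cost f t x) + ext_indicator (ker_I_P E) y"
    using sol edge[of x'] unfolding is_primal_solution_def is_arg_min_def by auto
  ultimately have le': "ereal (total_cost f t x) + ext_indicator (ker_I_P E) y \<le> ereal (total_cost f t x')"
    by simp
  \<comment> \<open>An infinite objective would contradict \<open>le'\<close>, so the solution is
    feasible.\<close>
  then have "y \<in> ker_I_P E" by (rule contrapos_pp) (simp add: ext_indicator_def)
  with le' y have ker: "P_op (A_op E x) = A_op E x" and le: "total_cost f t x \<le> total_cost f t x'"
    by (auto simp: ext_indicator_def ker_I_P_def)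
  have "w \<bullet> (A_op E x - A_op E x') = 0"
    using P_op_inner[of w "A_op E x - A_op E x'"] opt ker by (simp add: linear_diff[OF linear_P_op])
  then have "stacked_grad f t x' \<bullet> (x - x') = 0"
    using adjoint_works[OF linear_A_op, of "x - x'" E w]
    by (simp add: opt(1) inner_commute linear_diff[OF linear_A_op])
  then have "\<mu> / 2 * (norm (x - x'))\<^sup>2 \<le> 0"
    using total_cost_lower_bound[where f = f and t = t, OF f, of x' x] le by simp
  then show ?thesis using \<open>\<mu> > 0\<close> by (simp add: mult_le_0_iff)
qed

lemma dual_cost_eq:
  assumes f: "\<And>i. (\<lambda>u. f i u t) \<in> S_class \<mu> L" and "\<mu> > 0" "sym E" "w \<in> edge_space E"
    and x: "stacked_grad f t x = adjoint (A_op E) w"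
  shows "dual_cost E f t w =
    (if P_op w = - w then ereal (adjoint (A_op E) w \<bullet> x - total_cost f t x) else \<infinity>)"
proof -
  have "total_cost f t x + adjoint (A_op E) w \<bullet> (y - x) \<le> total_cost f t y" for y
  proof -
    have "0 \<le> \<mu> / 2 * (norm (y - x))\<^sup>2" using \<open>\<mu> > 0\<close> by simp
    then show ?thesis using total_cost_lower_bound[where f = f and t = t, OF f, of x y] x by simp
  qed
  from convex_conj_gradient[of "total_cost f t", OF this] show ?thesis
    unfolding dual_cost_def convex_conj_indicator_ker[OF assms(3,4)] by simp
qed

text \<open>First-order optimality is derived without differentiating the conjugate. Moving from
  \<open>w\<close> by s v changes the dual cost by at most s (v . A x'), where \<open>x'\<close> is
  the partner of the displaced point; minimality for small s then forces v = 0.\<close>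

lemma dual_solution_dual_opt:
  fixes E :: "('v::finite \<times> 'v) set" and w :: "real^'n^('v \<times> 'v)"
  assumes cd: "consensus_dual (A_op E :: real^'n^'v \<Rightarrow> _) P_op \<mu> L d"
    and f: "\<And>i. (\<lambda>u. f i u t) \<in> S_class \<mu> L" and "sym E" and sol: "is_dual_solution E f t w"
  obtains x where "consensus_dual.dual_opt (A_op E) P_op 0 (stacked_grad f t) w x"
proof -
  interpret consensus_dual "A_op E :: real^'n^'v \<Rightarrow> _" P_op \<mu> L d by (rule cd)
  let ?F = "stacked_grad f t"
  have reg: "regular ?F"
    by (intro stack_strongly_monotone_lipschitz S_class_gradient f L_pos)
  have w: "w \<in> edge_space E" and min: "\<And>v. v \<in> edge_space E \<Longrightarrow> dual_cost E f t w \<le> dual_cost E f t v"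
    using sol by (auto simp: is_dual_solution_def is_arg_min_def not_less)
  note cost = dual_cost_eq[where f = f and t = t, OF f mu_pos \<open>sym E\<close>]
  obtain x where x: "dual_pair ?F w x" using dual_pair_exists[OF reg] by blast
  obtain x0 where x0: "dual_pair ?F 0 x0" using dual_pair_exists[OF reg] by blast
  have Pw: "P_op w = - w"
  proof (rule ccontr)
    assume "P_op w \<noteq> - w"
    then have "dual_cost E f t w = \<infinity>" using cost[OF w, of x] x by (simp add: dual_pair_def)
    moreover have "dual_cost E f t 0 \<noteq> \<infinity>"
      using cost[OF zero_edge_space, of x0] x0 linear_0[OF linear_P] by (simp add: dual_pair_def)
    ultimately show False using min[OF zero_edge_space] by simp
  qed
  \<comment> \<open>Minus twice the antisymmetric part of the dual gradient A x: a direction of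
    descent that stays feasible.\<close>
  define v where "v = P_op (A_op E x) - A_op E x"
  have Pv: "P_op v = - v" by (simp add: v_def P_diff P_P)
  have v: "v \<in> edge_space E"
  proof -
    have "A_op E x \<in> edge_space E" by (simp add: A_op_def edge_space_def)
    with P_op_edge_space[OF \<open>sym E\<close> this] show ?thesis by (simp add: v_def edge_space_def)
  qed
  have descent: "(norm v)\<^sup>2 / 2 \<le> s * (d / \<mu> * (norm v)\<^sup>2)" if s: "s > 0" for s
  proof -
    let ?u = "w + s *\<^sub>R v"
    obtain x' where x': "dual_pair ?F ?u x'" using dual_pair_exists[OF reg] by blast
    have u: "?u \<in> edge_space E" using w v by (simp add: edge_space_def)
    have Pu: "P_op ?u = - ?u" by (simp add: P_add P_scaleR Pw Pv)
    have "dual_cost E f t w \<le> dual_cost E f t ?u" by (rule min[OF u])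
    then have "adjoint (A_op E) w \<bullet> x - total_cost f t x \<le> adjoint (A_op E) ?u \<bullet> x' - total_cost f t x'"
      using cost[OF w, of x] cost[OF u, of x'] x x' Pw Pu by (simp add: dual_pair_def)
    moreover have "adjoint (A_op E) w \<bullet> x' - total_cost f t x' \<le> adjoint (A_op E) w \<bullet> x - total_cost f t x"
    proof -
      have "0 \<le> \<mu> / 2 * (norm (x' - x))\<^sup>2" using mu_pos by simp
      then show ?thesis using total_cost_lower_bound[where f = f and t = t, OF f, of x x'] x
        by (simp add: dual_pair_def inner_diff_right)
    qed
    moreover have "adjoint (A_op E) ?u \<bullet> x' - adjoint (A_op E) w \<bullet> x' = s * (v \<bullet> A_op E x')"
      by (simp add: inner_adjoint inner_add_left)
    ultimately have "0 \<le> s * (v \<bullet> A_op E x')" by linarith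
    then have "0 \<le> v \<bullet> A_op E x'" using s by (simp add: zero_le_mult_iff)
    moreover have "v \<bullet> (A_op E x' - A_op E x) \<le> norm v * (d / \<mu> * norm (s *\<^sub>R v))"
      using dual_pair_lipschitz[OF reg x' x] norm_cauchy_schwarz[of v "A_op E x' - A_op E x"]
      by (smt (verit) add_diff_cancel_left' mult_left_mono norm_ge_zero)
    moreover have "v \<bullet> A_op E x = - ((norm v)\<^sup>2 / 2)"
    proof -
      have "v \<bullet> P_op (A_op E x) = - (v \<bullet> A_op E x)" using P_inner[of v "A_op E x"] Pv by simp
      then have "v \<bullet> v = - 2 * (v \<bullet> A_op E x)" by (subst (2) v_def) (simp add: inner_diff_right)
      then show ?thesis by (simp add: power2_norm_eq_inner)
    qed
    ultimately have "(norm v)\<^sup>2 / 2 \<le> norm v * (d / \<mu> * norm (s *\<^sub>R v))"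
      unfolding inner_diff_right by linarith
    then show ?thesis using s by (simp add: power2_eq_square mult_ac)
  qed
  \<comment> \<open>This choice of s makes the right-hand side half of the left-hand side.\<close>
  have "(norm v)\<^sup>2 / 2 \<le> (norm v)\<^sup>2 / 4"
    using descent[of "\<mu> / (4 * d)"] mu_pos d_pos by simp
  then have "v = 0" by simp
  then have "P_op (A_op E x) = A_op E x" by (simp add: v_def)
  then show thesis using that[of x] x Pw by (simp add: dual_opt_def)
qed

text \<open>Strong monotonicity converts dual errors into primal ones and is the source of the
  factor |A| / \<mu> in the final bound.\<close>

lemma norm_diff_le_dual:
  fixes x x' :: "real^'n^'v::finite"
  assumes F: "strongly_monotone_lipschitz \<mu> L F" and "\<mu> > 0"
    and x: "F x = adjoint (A_op E) w" "F x' = adjoint (A_op E) w'"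
  shows "norm (x - x') \<le> sqrt (real (max_degree E)) / \<mu> * norm (w - w')"
proof -
  have "\<mu> * (norm (x - x'))\<^sup>2 \<le> (F x - F x') \<bullet> (x - x')"
    using F unfolding strongly_monotone_lipschitz_def by blast
  also have "\<dots> = (w - w') \<bullet> A_op E (x - x')"
    using adjoint_works[OF linear_A_op, of "x - x'" E "w - w'"]
    by (simp add: x linear_diff[OF adjoint_linear[OF linear_A_op]] inner_commute)
  also have "\<dots> \<le> norm (w - w') * norm (A_op E (x - x'))" by (rule norm_cauchy_schwarz)
  also have "\<dots> \<le> norm (w - w') * (sqrt (real (max_degree E)) * norm (x - x'))"
    by (intro mult_left_mono norm_A_op) auto
  finally have "\<mu> * norm (x - x') * norm (x - x')
      \<le> sqrt (real (max_degree E)) * norm (w - w') * norm (x - x')"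
    by (simp add: power2_eq_square mult_ac)
  then have "\<mu> * norm (x - x') \<le> sqrt (real (max_degree E)) * norm (w - w')"
    by (cases "x = x'") (auto simp: mult_le_cancel_right)
  then show ?thesis using \<open>\<mu> > 0\<close> by (simp add: field_simps)
qed

section \<open>Signs of the constants and the graph without edges\<close>

lemma rate_nonneg: "0 \<le> rate d \<mu> \<rho> \<epsilon>"
  unfolding rate_def by (rule max.coboundedI1) simp

text \<open>The second bound shows that \<open>eta1\<close> below 1 forces at least one correction
  step, so that \<open>zeta\<close> at \<open>NC\<close> is given by its formula with
  \<open>omega\<close>.\<close>

lemma
  assumes "d \<ge> 0" "\<mu> > 0" "\<rho> > 0" "\<epsilon> > 0"
  shows eta1_nonneg: "0 \<le> eta1 d \<mu> \<rho> NP NC \<epsilon>"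
    and eta1_no_correction: "1 \<le> eta1 d \<mu> \<rho> NP 0 \<epsilon>"
proof -
  have \<omega>: "0 \<le> omega d \<mu> \<rho> \<epsilon>" using assms by (simp add: omega_def L_bar_def mu_bar_def)
  then have z: "0 \<le> zeta d \<mu> \<rho> l \<epsilon>" and x: "0 \<le> xi d \<mu> \<rho> l \<epsilon>" for l
    by (simp_all add: zeta_def xi_def rate_nonneg)
  have \<kappa>: "1 \<le> kappa_bar d \<mu> \<epsilon>" using assms by (simp add: kappa_bar_def L_bar_def mu_bar_def)
  show "0 \<le> eta1 d \<mu> \<rho> NP NC \<epsilon>"
    unfolding eta1_def using z x \<kappa> by (intro mult_nonneg_nonneg add_nonneg_nonneg) auto
  show "1 \<le> eta1 d \<mu> \<rho> NP 0 \<epsilon>"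
  proof (cases "NP = 0")
    case False
    then have \<xi>: "1 \<le> xi d \<mu> \<rho> NP \<epsilon>" using \<omega> by (simp add: xi_def rate_nonneg)
    have "1 \<le> kappa_bar d \<mu> \<epsilon> * xi d \<mu> \<rho> NP \<epsilon>" using mult_mono[OF \<kappa> \<xi>] \<kappa> by simp
    then show ?thesis using z[of NP] by (simp add: eta1_def zeta_def[of _ _ _ 0])
  qed (simp add: eta1_def zeta_def xi_def)
qed

text \<open>Without edges the penalty and the coupling vanish, so every corrected iterate is the
  exact minimizer. This case is separate because \<open>consensus_dual\<close> requires d >
  0.\<close>

lemma pc_admm_sequence_edgeless:
  fixes x :: "nat \<Rightarrow> real^'n^'v::finite"
  assumes f: "\<And>i k. (\<lambda>u. f i u (t k)) \<in> S_class \<mu> L" and pos: "\<mu> > 0" "L > 0" "\<epsilon> > 0" "\<rho> > 0"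
    and E: "E = {}" and seq: "pc_admm_sequence E f t Ts \<epsilon> \<rho> NP NC x"
    and sol: "is_primal_solution E f (t (Suc k)) xs ys"
  shows "x (Suc k) = xs"
proof -
  obtain z where "\<And>i. x (Suc k) $ i = local_min E \<epsilon> \<rho> (\<lambda>i u. f i u (t (Suc k))) (z (Suc k)) i"
    using seq unfolding pc_admm_sequence_def by blast
  then have "grad (\<lambda>u. f i u (t (Suc k))) (x (Suc k) $ i) = 0" for i
    using local_min_stationary[where E = E and g = "\<lambda>i u. f i u (t (Suc k))" and z = "z (Suc k)",
        OF S_class_gradient[OF f] pos]
    by (simp add: E)
  then have "stacked_grad f (t (Suc k)) (x (Suc k)) = 0"
    unfolding stack_def by (simp add: zero_vec_def)
  moreover have "adjoint (A_op E) (0 :: real^'n^('v \<times> 'v)) = (0 :: real^'n^'v)"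
    using linear_0[OF adjoint_linear[OF linear_A_op]] by blast
  moreover have "A_op E (x (Suc k)) = 0" by (simp add: E A_op_def vec_eq_iff)
  ultimately show ?thesis
    using primal_solution_eq[where f = f and t = "t (Suc k)", OF f pos(1) sol, of "x (Suc k)" 0]
    by (simp add: linear_0[OF linear_P_op])
qed

section \<open>Tracking of the optimal trajectory\<close>

theorem corollary2:
  fixes E :: "('v::finite \<times> 'v) set"
    and f :: "'v \<Rightarrow> real^'n \<Rightarrow> real \<Rightarrow> real"
    and t :: "nat \<Rightarrow> real" and Ts :: real
    and \<mu> L C0 C :: real
    and xs :: "nat \<Rightarrow> real^'n^'v"
    and ys ws :: "nat \<Rightarrow> real^'n^('v \<times> 'v)"
    and Eps :: "real set"
  assumes "connected_graph E"
    and "0 \<le> t 0" and "\<And>k. t (Suc k) - t k = Ts" and "Ts > 0"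
    and "\<mu> > 0" and "L > 0" and "C0 \<ge> 0"
    and "\<And>i s. s \<ge> 0 \<Longrightarrow> (\<lambda>u. f i u s) \<in> S_class \<mu> L"
    and "\<And>i u s. s \<ge> 0 \<Longrightarrow> grad (\<lambda>v. f i v s) differentiable (at u)"
    and "\<And>i u s. s \<ge> 0 \<Longrightarrow>
          (\<lambda>r. grad (\<lambda>v. f i v r) u) differentiable (at s within {0..})"
    and "\<And>i u s. s \<ge> 0 \<Longrightarrow>
          norm (vector_derivative (\<lambda>r. grad (\<lambda>v. f i v r) u) (at s within {0..})) \<le> C0"
    and "\<And>k. is_primal_solution E f (t k) (xs k) (ys k)"
    and "\<And>k. is_dual_solution E f (t k) (ws k)"
    and "Eps \<subseteq> {0<..}"
    and "\<And>k \<epsilon>. \<epsilon> \<in> Eps \<Longrightarrow>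
          max (norm (ws k)) (norm (reg_dual_solution E f \<epsilon> (t k))) \<le> C"
  shows "\<exists>\<psi>0>0. \<forall>\<^sub>F \<epsilon> in at_right 0. \<epsilon> \<in> Eps \<longrightarrow>
    (let d = real (max_degree E) in
     \<forall>\<rho> NP NC x. \<rho> > 0 \<longrightarrow> eta1 d \<mu> \<rho> NP NC \<epsilon> < 1 \<longrightarrow>
       pc_admm_sequence E f t Ts \<epsilon> \<rho> NP NC x \<longrightarrow>
       limsup (\<lambda>k. ereal (norm (x k - xs k)))
         \<le> ereal (onorm (A_op E) / \<mu> *
             (eta0 d \<mu> C0 Ts \<rho> NP NC \<epsilon> / (1 - eta1 d \<mu> \<rho> NP NC \<epsilon>)
              + C * (1 + \<psi>0 * \<epsilon>))))"
proof -
  note mu_pos = \<open>\<mu> > 0\<close> and L_pos = \<open>L > 0\<close>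
  have "sym E" using assms(1) by (simp add: connected_graph_def)
  have t: "0 \<le> t k" "t k \<le> t (Suc k)" for k
  proof -
    have step: "t (Suc k) = t k + Ts" for k using assms(3)[of k] by simp
    show "0 \<le> t k" using assms(2,4) by (induction k) (simp_all add: step)
    show "t k \<le> t (Suc k)" using assms(4) by (simp add: step)
  qed
  have f: "(\<lambda>u. f i u (t k)) \<in> S_class \<mu> L" for i k using assms(8) t by blast
  define d where "d = real (max_degree E)"
  let ?A = "A_op E :: real^'n^'v \<Rightarrow> real^'n^('v \<times> 'v)"

  \<comment> \<open>The bound is first shown with C alone; the final form with \<psi>0 = 1 follows
    from it by the slack at the end.\<close>
  have "\<exists>\<epsilon>0>0. \<forall>\<epsilon>. \<epsilon> \<in> Eps \<longrightarrow> 0 < \<epsilon> \<longrightarrow> \<epsilon> < \<epsilon>0 \<longrightarrow>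
     (\<forall>\<rho> NP NC x. \<rho> > 0 \<longrightarrow> eta1 d \<mu> \<rho> NP NC \<epsilon> < 1 \<longrightarrow>
       pc_admm_sequence E f t Ts \<epsilon> \<rho> NP NC x \<longrightarrow>
       limsup (\<lambda>k. ereal (norm (x k - xs k)))
         \<le> ereal (sqrt d / \<mu> * (eta0 d \<mu> C0 Ts \<rho> NP NC \<epsilon> / (1 - eta1 d \<mu> \<rho> NP NC \<epsilon>) + C)))"
  proof (cases "max_degree E = 0")
    case True
    have "card (E `` {i}) \<le> max_degree E" for i unfolding max_degree_def by (rule Max_ge) auto
    with True have "E `` {i} = {}" for i by simp
    then have "E = {}" by auto
    show ?thesis
    proof (intro exI[of _ 1] conjI allI impI)
      fix \<epsilon> \<rho> NP NC x
      assume "0 < \<epsilon>" "\<rho> > 0" "pc_admm_sequence E f t Ts \<epsilon> \<rho> NP NC x"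
      then have "x (Suc k) = xs (Suc k)" for k
        using pc_admm_sequence_edgeless[where f = f and t = t, OF f] assms(12) mu_pos L_pos \<open>E = {}\<close> by blast
      then have "limsup (\<lambda>k. ereal (norm (x (Suc k) - xs (Suc k)))) = 0" by (simp add: Limsup_const)
      then show "limsup (\<lambda>k. ereal (norm (x k - xs k)))
        \<le> ereal (sqrt d / \<mu> * (eta0 d \<mu> C0 Ts \<rho> NP NC \<epsilon> / (1 - eta1 d \<mu> \<rho> NP NC \<epsilon>) + C))"
        using limsup_shift[of "\<lambda>k. ereal (norm (x k - xs k))"] by (simp add: d_def True)
    qed simp
  next
    case False
    have cd: "consensus_dual ?A P_op \<mu> L d"
      unfolding d_def using consensus_dual_A_op mu_pos L_pos False by blast
    interpret consensus_dual ?A P_op \<mu> L d by (rule cd)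
    obtain c where c: "c > 0" and gap: "\<And>F w1 x1 w2 x2. \<lbrakk>regular F; dual_pair F w1 x1; dual_pair F w2 x2;
       w1 - w2 \<in> range (\<lambda>x. A_op E x - P_op (A_op E x))\<rbrakk> \<Longrightarrow>
       c * (norm (w1 - w2))\<^sup>2 \<le> (w1 - w2) \<bullet> (A_op E x1 - A_op E x2)"
      by (rule uniform_gap) blast
    define r where "r = sqrt (real CARD('v))"
    have r: "r > 0" by (simp add: r_def)
    define F where "F k = stacked_grad f (t k)" for k
    have regF: "regular (F k)" for k
      unfolding F_def by (intro stack_strongly_monotone_lipschitz S_class_gradient f L_pos)
    \<comment> \<open>These are the three smallness conditions of
      \<open>prediction_correction_step\<close>, each solved for \<epsilon>.\<close>
    define \<epsilon>0 where "\<epsilon>0 = min (c / (2 * r)) (min (d / \<mu> / (2 * r)) (d / \<mu> / (3 * (d / \<mu>) / c + 3)))"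
    have "\<epsilon>0 > 0"
      using c r d_pos mu_pos by (auto simp: \<epsilon>0_def intro!: divide_pos_pos add_pos_pos mult_pos_pos)
    \<comment> \<open>The dual solution comes with some primal partner satisfying the optimality
      system; uniqueness identifies it with \<open>xs k\<close>.\<close>
    have opt0: "dual_opt 0 (F k) (ws k) (xs k)" for k
    proof -
      obtain x where x: "dual_opt 0 (F k) (ws k) x"
        using dual_solution_dual_opt[where f = f and t = "t k", OF cd f \<open>sym E\<close> assms(13)] unfolding F_def .
      then have "xs k = x"
        by (intro primal_solution_eq[where f = f and t = "t k", OF f mu_pos assms(12), where w = "ws k"])
          (simp_all add: dual_opt_def dual_pair_def F_def)
      with x show ?thesis by simp
    qed
    define b where "b = r * (C0 * Ts)"
    have drift: "norm (F k x - F (Suc k) x) \<le> b" for k x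
      unfolding b_def r_def
    proof (rule norm_vec_le_uniform)
      fix i
      have "norm (grad (\<lambda>u. f i u (t k)) (x $ i) - grad (\<lambda>u. f i u (t (Suc k))) (x $ i)) \<le> C0 * (t (Suc k) - t k)"
        by (rule gradient_time_drift[of "\<lambda>s. grad (\<lambda>u. f i u s) (x $ i)"]) (use assms(10,11) t in auto)
      then show "norm ((F k x - F (Suc k) x) $ i) \<le> C0 * Ts"
        by (simp add: F_def stack_def assms(3))
    qed (use assms(4,7) in simp)
    have bC: "sqrt d * b / \<mu> \<le> r * (C0_bar d \<mu> C0 * Ts)" "0 \<le> C0_bar d \<mu> C0 * Ts"
      using assms(4,5,7) by (simp_all add: b_def C0_bar_def d_def mult_ac)
    show ?thesis
    proof (intro exI[of _ \<epsilon>0] conjI allI impI)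
      show "\<epsilon>0 > 0" by fact
      fix \<epsilon> \<rho> NP NC x
      assume "\<epsilon> \<in> Eps" and \<epsilon>: "0 < \<epsilon>" "\<epsilon> < \<epsilon>0" and \<rho>: "\<rho> > 0"
        and \<eta>: "eta1 d \<mu> \<rho> NP NC \<epsilon> < 1" and seq: "pc_admm_sequence E f t Ts \<epsilon> \<rho> NP NC x"
      have small: "2 * r * \<epsilon> \<le> c" "2 * r * \<epsilon> \<le> d / \<mu>" "\<epsilon> * (3 * (d / \<mu>) / c + 3) \<le> d / \<mu>"
      proof -
        have "\<epsilon> \<le> c / (2 * r)" "\<epsilon> \<le> d / \<mu> / (2 * r)" "\<epsilon> \<le> d / \<mu> / (3 * (d / \<mu>) / c + 3)"
          using \<epsilon>(2) by (auto simp: \<epsilon>0_def)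
        moreover have "0 < 2 * r" "0 < 3 * (d / \<mu>) / c + 3"
          using r c d_pos mu_pos by (auto intro!: add_pos_pos divide_pos_pos)
        ultimately show "2 * r * \<epsilon> \<le> c" "2 * r * \<epsilon> \<le> d / \<mu>" "\<epsilon> * (3 * (d / \<mu>) / c + 3) \<le> d / \<mu>"
          by (simp_all only: pos_le_divide_eq mult.commute)
      qed
      have NC: "NC > 0"
        using eta1_no_correction[of d \<mu> \<rho> \<epsilon> NP] \<eta> d_pos mu_pos \<rho> \<epsilon> by (cases NC) auto
      obtain z zh fh where z0: "z 0 = 0" and
        fh: "\<And>k i y. GDERIV (fh (Suc k) i) y :> predicted_grad (f i) (t k) Ts (x k $ i) y" and
        zh: "\<And>k. zh (Suc k) = (admm_step E \<epsilon> \<rho> (fh (Suc k)) ^^ NP) (z k)" and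
        z: "\<And>k. z (Suc k) = (admm_step E \<epsilon> \<rho> (\<lambda>i u. f i u (t (Suc k))) ^^ NC) (zh (Suc k))" and
        x: "\<And>k i. x (Suc k) $ i = local_min E \<epsilon> \<rho> (\<lambda>i u. f i u (t (Suc k))) (z (Suc k)) i"
        using seq unfolding pc_admm_sequence_def by blast
      have zE: "z k \<in> edge_space E" for k
        by (induction k) (simp_all add: z0 z zh zero_edge_space funpow_admm_step_edge_space)
      have zhE: "zh (Suc k) \<in> edge_space E" for k
        using zE by (simp add: zh funpow_admm_step_edge_space)
      define Fh where "Fh k = stack (\<lambda>i. predicted_grad (f i) (t k) Ts (x k $ i))" for k
      have sml: "strongly_monotone_lipschitz \<mu> L (predicted_grad (f i) (t k) Ts (x k $ i))" for i k
        unfolding predicted_grad_def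
        by (intro frechet_derivative_strongly_monotone_lipschitz S_class_gradient f assms(9) t)
      have regFh: "regular (Fh k)" for k
        unfolding Fh_def by (intro stack_strongly_monotone_lipschitz sml L_pos)
      have resF: "\<exists>w. dual_pair (F k) w (\<chi> i. local_min E \<epsilon> \<rho> (\<lambda>i u. f i u (t k)) y i)
          \<and> lift \<epsilon> \<rho> w (\<chi> i. local_min E \<epsilon> \<rho> (\<lambda>i u. f i u (t k)) y i) = y
          \<and> admm_step E \<epsilon> \<rho> (\<lambda>i u. f i u (t k)) y = - P_op (2 *\<^sub>R w - y)"
        if "y \<in> edge_space E" for k y
        using admm_step_resolvent[where g = "\<lambda>i u. f i u (t k)",
            OF S_class_gradient[OF f] mu_pos L_pos \<epsilon>(1) \<rho> \<open>sym E\<close> that]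
        unfolding dual_pair_def F_def lift_def by metis
      have stepF: "admm_step E \<epsilon> \<rho> (\<lambda>i u. f i u (t k)) y \<in> edge_space E \<and>
          (\<exists>w x. dual_pair (F k) w x \<and> lift \<epsilon> \<rho> w x = y \<and>
             admm_step E \<epsilon> \<rho> (\<lambda>i u. f i u (t k)) y = - P_op (2 *\<^sub>R w - y))"
        if "y \<in> edge_space E" for k y
        using resF[OF that] admm_step_edge_space by blast
      have stepFh: "admm_step E \<epsilon> \<rho> (fh (Suc k)) y \<in> edge_space E \<and>
          (\<exists>w x. dual_pair (Fh k) w x \<and> lift \<epsilon> \<rho> w x = y \<and>
             admm_step E \<epsilon> \<rho> (fh (Suc k)) y = - P_op (2 *\<^sub>R w - y))"
        if yE: "y \<in> edge_space E" for k y
      proof -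
        let ?x = "\<chi> i. local_min E \<epsilon> \<rho> (fh (Suc k)) y i"
        obtain w where "stack (\<lambda>i. predicted_grad (f i) (t k) Ts (x k $ i)) ?x = adjoint (A_op E) w"
          "w + \<rho> *\<^sub>R (\<epsilon> *\<^sub>R w + A_op E ?x) = y"
          "admm_step E \<epsilon> \<rho> (fh (Suc k)) y = - P_op (2 *\<^sub>R w - y)"
          by (rule admm_step_resolvent[OF fh[of k] sml[of _ k] mu_pos L_pos \<epsilon>(1) \<rho> \<open>sym E\<close> yE])
        then have "dual_pair (Fh k) w ?x" "lift \<epsilon> \<rho> w ?x = y"
          "admm_step E \<epsilon> \<rho> (fh (Suc k)) y = - P_op (2 *\<^sub>R w - y)"
          unfolding dual_pair_def Fh_def lift_def .
        then show ?thesis using admm_step_edge_space by blast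
      qed
      have "\<exists>w. dual_pair (F (Suc k)) w (x (Suc k)) \<and> lift \<epsilon> \<rho> w (x (Suc k)) = z (Suc k)" for k
      proof -
        have "x (Suc k) = (\<chi> i. local_min E \<epsilon> \<rho> (\<lambda>i u. f i u (t (Suc k))) (z (Suc k)) i)"
          by (simp add: vec_eq_iff x)
        then show ?thesis using resF[OF zE, of "Suc k" "Suc k"] by auto
      qed
      then obtain w' where w': "\<And>k. dual_pair (F (Suc k)) (w' k) (x (Suc k))"
        "\<And>k. lift \<epsilon> \<rho> (w' k) (x (Suc k)) = z (Suc k)" by metis
      have "\<exists>w x. dual_opt \<epsilon> (F k) w x" for k using dual_opt_exists[OF regF \<epsilon>(1)] by blast
      then obtain we xe where opt: "\<And>k. dual_opt \<epsilon> (F k) (we k) (xe k)" by metis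
      \<comment> \<open>For k \<ge> 1, \<open>w' (k - 1)\<close> is the dual vector of
        \<open>x k\<close> and \<open>z k\<close>. At k = 0 truncated subtraction yields a value
        without meaning, so all estimates start at 1.\<close>
      define e where "e k = norm (w' (k - 1) - we k)" for k
      have rec: "e (Suc k) \<le> eta1 d \<mu> \<rho> NP NC \<epsilon> * e k + eta0 d \<mu> C0 Ts \<rho> NP NC \<epsilon>" if k: "k \<ge> 1" for k
      proof -
        obtain m where m: "k = Suc m" using k by (cases k) auto
        obtain wh xh where opth: "dual_opt \<epsilon> (Fh k) wh xh" using dual_opt_exists[OF regFh \<epsilon>(1)] by blast
        \<comment> \<open>At the expansion point the Hessian term vanishes, so the predicted
          gradient differs from the current one only by \<open>Ts\<close> times the time
          derivative.\<close>
        have "norm (F k (x k) - Fh k (x k)) \<le> b"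
          unfolding b_def r_def
        proof (rule norm_vec_le_uniform)
          fix i
          let ?v = "vector_derivative (\<lambda>s. grad (\<lambda>u. f i u s) (x k $ i)) (at (t k) within {0..})"
          have "frechet_derivative (grad (\<lambda>u. f i u (t k))) (at (x k $ i)) 0 = 0"
            using assms(9)[OF t(1)] linear_frechet_derivative linear_0 by blast
          then have "(F k (x k) - Fh k (x k)) $ i = - (Ts *\<^sub>R ?v)"
            by (simp add: F_def Fh_def stack_def predicted_grad_def)
          moreover have "Ts * norm ?v \<le> Ts * C0"
            using assms(4) assms(11)[OF t(1)] by (intro mult_left_mono) auto
          ultimately show "norm ((F k (x k) - Fh k (x k)) $ i) \<le> C0 * Ts"
            using assms(4) by (simp add: mult.commute)
        qed (use assms(4,7) in simp)
        moreover have "norm (zh (Suc k) - lift \<epsilon> \<rho> wh xh)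
            \<le> rate d \<mu> \<rho> \<epsilon> ^ NP * norm (lift \<epsilon> \<rho> (w' m) (x k) - lift \<epsilon> \<rho> wh xh)"
          using iterate_contraction(1)[OF regFh \<epsilon>(1) \<rho> opth stepFh zE, of NP k] by (simp add: zh m w')
        moreover have "norm (lift \<epsilon> \<rho> (w' k) (x (Suc k)) - lift \<epsilon> \<rho> (we (Suc k)) (xe (Suc k)))
            \<le> rate d \<mu> \<rho> \<epsilon> ^ NC * norm (zh (Suc k) - lift \<epsilon> \<rho> (we (Suc k)) (xe (Suc k)))"
          using iterate_contraction(1)[OF regF \<epsilon>(1) \<rho> opt stepF zhE, of NC "Suc k" k] by (simp add: z w')
        moreover have "zh (Suc k) = lift \<epsilon> \<rho> (w' m) (x k)" if "NP = 0"
          using that by (simp add: zh m w')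
        moreover have "dual_pair (F k) (w' m) (x k)" using w'(1)[of m] by (simp add: m)
        ultimately have "norm (w' k - we (Suc k))
            \<le> eta1 d \<mu> \<rho> NP NC \<epsilon> * norm (w' m - we k) + eta0 d \<mu> C0 Ts \<rho> NP NC \<epsilon>"
          by (intro prediction_correction_step[OF c gap regF regFh regF \<epsilon>(1) \<rho> opt opth opt _ w'(1)
                drift _ _ _ _ NC bC small])
        then show ?thesis by (simp add: e_def m)
      qed
      have bound: "norm (x k - xs k) \<le> sqrt d / \<mu> * (e k + C)" if k: "k \<ge> 1" for k
      proof -
        obtain m where m: "k = Suc m" using k by (cases k) auto
        have "norm (we k - ws k) \<le> norm (ws k)"
          by (rule dual_opt_regularization_error[OF regF opt opt0 \<epsilon>(1)])
        also have "\<dots> \<le> C" using assms(15)[OF \<open>\<epsilon> \<in> Eps\<close>, of k] by simp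
        finally have "norm (w' m - ws k) \<le> e k + C"
          using norm_triangle_ineq[of "w' m - we k" "we k - ws k"] by (simp add: e_def m)
        then have "sqrt d / \<mu> * norm (w' m - ws k) \<le> sqrt d / \<mu> * (e k + C)"
          using d_pos mu_pos by (intro mult_left_mono) auto
        moreover have "norm (x k - xs k) \<le> sqrt d / \<mu> * norm (w' m - ws k)"
          using norm_diff_le_dual[OF regF[of k] mu_pos, of "x k" E "w' m" "xs k" "ws k"] w'(1)[of m] opt0[of k]
          by (simp add: m dual_opt_def dual_pair_def d_def)
        ultimately show ?thesis by linarith
      qed
      show "limsup (\<lambda>k. ereal (norm (x k - xs k)))
         \<le> ereal (sqrt d / \<mu> * (eta0 d \<mu> C0 Ts \<rho> NP NC \<epsilon> / (1 - eta1 d \<mu> \<rho> NP NC \<epsilon>) + C))"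
      proof (rule limsup_affine_recursion[where e = e, OF rec _ \<eta> _ bound])
        show "0 \<le> eta1 d \<mu> \<rho> NP NC \<epsilon>"
          using d_pos mu_pos \<rho> \<epsilon> by (intro eta1_nonneg) auto
        show "0 \<le> sqrt d / \<mu>" using d_pos mu_pos by simp
      qed
    qed
  qed
  then obtain \<epsilon>0 where "\<epsilon>0 > 0" and main: "\<And>\<epsilon> \<rho> NP NC x. \<epsilon> \<in> Eps \<Longrightarrow> 0 < \<epsilon> \<Longrightarrow> \<epsilon> < \<epsilon>0 \<Longrightarrow>
     \<rho> > 0 \<Longrightarrow> eta1 d \<mu> \<rho> NP NC \<epsilon> < 1 \<Longrightarrow> pc_admm_sequence E f t Ts \<epsilon> \<rho> NP NC x \<Longrightarrow>
       limsup (\<lambda>k. ereal (norm (x k - xs k)))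
         \<le> ereal (sqrt d / \<mu> * (eta0 d \<mu> C0 Ts \<rho> NP NC \<epsilon> / (1 - eta1 d \<mu> \<rho> NP NC \<epsilon>) + C))"
    by blast
  \<comment> \<open>A member of \<open>Eps\<close> makes C a bound for a norm and hence
    non-negative.\<close>
  have slack: "ereal (sqrt d / \<mu> * (a + C)) \<le> ereal (sqrt d / \<mu> * (a + C * (1 + 1 * \<epsilon>)))"
    if "\<epsilon> \<in> Eps" for \<epsilon> a
  proof -
    have "0 \<le> C" using assms(15)[OF that, of 0] norm_ge_zero[of "ws 0"] by linarith
    moreover have "0 < \<epsilon>" using that assms(14) by auto
    ultimately have "a + C \<le> a + C * (1 + 1 * \<epsilon>)" by (simp add: distrib_left)
    then show ?thesis using mu_pos by (simp only: ereal_less_eq) (intro mult_left_mono; simp add: d_def)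
  qed
  show ?thesis
    unfolding Let_def onorm_A_op d_def[symmetric]
  proof (intro exI[of _ 1] conjI)
    have "\<forall>\<^sub>F \<epsilon> in at_right 0. \<epsilon> \<in> {0<..<\<epsilon>0}"
      using \<open>\<epsilon>0 > 0\<close> by (rule eventually_at_right_real)
    then show "\<forall>\<^sub>F \<epsilon> in at_right 0. \<epsilon> \<in> Eps \<longrightarrow>
     (\<forall>\<rho> NP NC x. \<rho> > 0 \<longrightarrow> eta1 d \<mu> \<rho> NP NC \<epsilon> < 1 \<longrightarrow>
       pc_admm_sequence E f t Ts \<epsilon> \<rho> NP NC x \<longrightarrow>
       limsup (\<lambda>k. ereal (norm (x k - xs k)))
         \<le> ereal (sqrt d / \<mu> *
             (eta0 d \<mu> C0 Ts \<rho> NP NC \<epsilon> / (1 - eta1 d \<mu> \<rho> NP NC \<epsilon>) + C * (1 + 1 * \<epsilon>))))"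
    proof (rule eventually_mono, intro impI allI)
      fix \<epsilon> \<rho> NP NC x
      assume *: "\<epsilon> \<in> {0<..<\<epsilon>0}" "\<epsilon> \<in> Eps" "\<rho> > 0" "eta1 d \<mu> \<rho> NP NC \<epsilon> < 1"
        "pc_admm_sequence E f t Ts \<epsilon> \<rho> NP NC x"
      show "limsup (\<lambda>k. ereal (norm (x k - xs k)))
         \<le> ereal (sqrt d / \<mu> *
             (eta0 d \<mu> C0 Ts \<rho> NP NC \<epsilon> / (1 - eta1 d \<mu> \<rho> NP NC \<epsilon>) + C * (1 + 1 * \<epsilon>)))"
        by (rule order_trans[OF main slack]) (use * in auto)
    qed
  qed simp
qed

end
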